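(* Let $n\geq 3$ be an integer, let $\lambda$ be a positive real number, and let $f(z)=z+\sum_{k=2}^{\infty}a_kz^k$ be a function in the class $\mathcal{C}$ of close-to-convex functions on the unit disk. (1) If $\lambda\geq\frac{3n+\sqrt{5n^2-4n}}{n^2+n}$, then $$|\lambda a_n^2-a_{2n-1}|\leq \lambda n^2-(2n-1),$$ where equality holds if $f$ is the Koebe function $f(z)=z/(1-z)^2$. (2) If $\frac{2n}{n^2-n+1}<\lambda<\frac{3n+\sqrt{5n^2-4n}}{n^2+n}$, then $$|\lambda a_n^2-a_{2n-1}|\leq \frac{\lambda\left[4n(n+1)-(3n^2+1)\lambda\right]+4n(2-\lambda)\sqrt{n\lambda(2-\lambda)}}{\lambda\left[8n-\lambda(n+1)^2\right]}.$$ (3) If $0<\lambda\leq\frac{2n}{n^2-n+1}$, then $$|\lambda a_n^2-a_{2n-1}|\leq 2n-1.$$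
   Context: Let $\mathbb{D}=\{z\in\mathbb{C}:|z|<1\}$. $\mathcal{S}$ is the family of univalent analytic functions in $\mathbb{D}$ of the form $f(z)=z+\sum_{k=2}^{\infty}a_kz^k$. A function $g\in\mathcal{S}$ is starlike if $g(\mathbb{D})$ is starlike with respect to the origin; $\mathcal{S}^*$ denotes the class of all starlike functions in $\mathcal{S}$. An analytic function $f$ in $\mathbb{D}$ of the form $f(z)=z+\sum_{k=2}^{\infty}a_kz^k$ is called close-to-convex if there exist a real number $\theta$ and a function $g\in\mathcal{S}^*$ such that $\mathrm{Re}\left(e^{i\theta}zf'(z)/g(z)\right)>0$ for $z\in\mathbb{D}$. $\mathcal{C}$ denotes the class of all close-to-convex functions. *)

theory Defs
  imports "HOL-Complex_Analysis.Complex_Analysis"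
begin

abbreviation unit_disk :: "complex set" where
  "unit_disk \<equiv> ball 0 1"

text \<open>
  The relation \<open>f(z) = z + (\<Sum>k\<ge>2. a k * z^k)\<close> on the unit disk; the values \<open>a 0\<close> and \<open>a 1\<close> play no role.
\<close>

definition has_normalized_expansion :: "(complex \<Rightarrow> complex) \<Rightarrow> (nat \<Rightarrow> complex) \<Rightarrow> bool" where
  "has_normalized_expansion f a \<longleftrightarrow>
     (\<forall>z\<in>unit_disk. (\<lambda>k. a (k + 2) * z ^ (k + 2)) sums (f z - z))"

definition normalized_analytic :: "(complex \<Rightarrow> complex) set" where
  "normalized_analytic =
     {f. f holomorphic_on unit_disk \<and> (\<exists>a. has_normalized_expansion f a)}"

definition class_S :: "(complex \<Rightarrow> complex) set" where
  "class_S = {f \<in> normalized_analytic. inj_on f unit_disk}"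

text \<open>
  The library predicate \<^const>\<open>starlike\<close> only asks for some star centre; here the centre is prescribed.
\<close>

definition starlike_wrt :: "complex \<Rightarrow> complex set \<Rightarrow> bool" where
  "starlike_wrt c A \<longleftrightarrow> c \<in> A \<and> (\<forall>w\<in>A. closed_segment c w \<subseteq> A)"

definition class_S_star :: "(complex \<Rightarrow> complex) set" where
  "class_S_star = {g \<in> class_S. starlike_wrt 0 (g ` unit_disk)}"

text \<open>
  For normalized \<open>f\<close> and univalent normalized \<open>g\<close>, the quotient \<open>z f'(z) / g(z)\<close> has a removable
  singularity at \<open>0\<close> with limit \<open>f'(0) / g'(0) = 1\<close>. That value is filled in explicitly, since division
  by zero would otherwise yield \<open>0\<close>.
\<close>

definition ctc_quotient :: "(complex \<Rightarrow> complex) \<Rightarrow> (complex \<Rightarrow> complex) \<Rightarrow> complex \<Rightarrow> complex" where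
  "ctc_quotient f g z = (if z = 0 then 1 else z * deriv f z / g z)"

definition close_to_convex :: "(complex \<Rightarrow> complex) set" where
  "close_to_convex =
     {f \<in> normalized_analytic. \<exists>\<theta>::real. \<exists>g\<in>class_S_star. \<forall>z\<in>unit_disk.
        Re (exp (\<i> * of_real \<theta>) * ctc_quotient f g z) > 0}"

definition koebe :: "complex \<Rightarrow> complex" where
  "koebe z = z / (1 - z)\<^sup>2"

end

theory Submission imports Defs begin

text \<open>
  If \<open>g\<close> is starlike, Jack's lemma gives \<open>g(z)/z = P(z)\<^sup>2\<close> with \<open>Re P > 1/2\<close>, so a close-to-convex \<open>f\<close>
  satisfies \<open>f' = P\<^sup>2 (-c + (1 + c) Q)\<close> with \<open>|c| = 1\<close> and \<open>Re Q > 1/2\<close>. Averaging over the circle replaces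
  \<open>P\<close> and \<open>Q\<close> by kernels \<open>1/(1 - yz)\<close>, and Feynman's parametrization merges the resulting product into
  averages of \<open>(1 + xz)/(1 - uz)\<^sup>3\<close>, with \<open>|u| = 1\<close> by the maximum principle. After a rotation the
  functional becomes \<open>\<lambda> (Re a\<^sub>n)\<^sup>2 - Re a\<^bsub>2n-1\<^esub>\<close>, a supremum of affine functionals
  \<open>\<lambda> (2 s Re a\<^sub>n - s\<^sup>2) - Re a\<^bsub>2n-1\<^esub>\<close>, so it suffices to bound it at these extremal functions. There it is
  a trigonometric function of two angles, estimated with Lagrange multipliers.
\<close>

section \<open>Jack's lemma\<close>

lemma has_real_derivative_cmod_power2:
  assumes "(\<gamma> has_vector_derivative D) (at t)"
  shows "((\<lambda>s. (cmod (\<gamma> s))\<^sup>2) has_real_derivative 2 * Re (cnj (\<gamma> t) * D)) (at t)"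
proof -
  have d: "((\<lambda>s. Re (\<gamma> s)) has_real_derivative Re D) (at t)" "((\<lambda>s. Im (\<gamma> s)) has_real_derivative Im D) (at t)"
    using bounded_linear.has_vector_derivative[OF bounded_linear_Re assms]
      bounded_linear.has_vector_derivative[OF bounded_linear_Im assms]
    by (simp_all add: has_real_derivative_iff_has_vector_derivative)
  from DERIV_add[OF DERIV_power[OF d(1), of 2] DERIV_power[OF d(2), of 2]] show ?thesis
    unfolding cmod_power2 by (simp add: algebra_simps)
qed

text \<open>A negative derivative would make \<open>\<phi>\<close> exceed \<open>\<phi> b\<close>
  just to the left of \<open>b\<close>. The comparison is one-sided because the Schwarz-type bounds
  below are available only for parameters \<open>t < 1\<close>.\<close>

lemma has_real_derivative_nonneg_at_right_end:
  fixes \<phi> :: "real \<Rightarrow> real"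
  assumes "(\<phi> has_real_derivative D) (at b)" "a < b" "\<And>t. a < t \<Longrightarrow> t < b \<Longrightarrow> \<phi> t \<le> \<phi> b"
  shows "D \<ge> 0"
proof (rule ccontr)
  assume "\<not> ?thesis"
  then obtain d where "d > 0" and d: "\<And>h. 0 < h \<Longrightarrow> h < d \<Longrightarrow> \<phi> b < \<phi> (b - h)"
    using DERIV_neg_dec_left[OF assms(1)] by auto
  define h where "h = min (d / 2) ((b - a) / 2)"
  have "0 < h" "h < d" "h < b - a"
    using \<open>d > 0\<close> \<open>a < b\<close> by (auto simp: h_def min_def)
  then show False using d[of h] assms(3)[of "b - h"] by simp
qed

lemma has_vector_derivative_ray:
  assumes "(k has_field_derivative k') (at c)"
  shows "((\<lambda>t. k (of_real t * c)) has_vector_derivative c * k') (at 1)"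
proof -
  have "((\<lambda>t. of_real t * c) has_vector_derivative c) (at 1)"
    by (auto intro!: derivative_eq_intros)
  then show ?thesis
    using field_vector_diff_chain_at[of "\<lambda>t. of_real t * c" c 1 k k'] assms by (simp add: o_def)
qed

text \<open>The points with real part above 1/2 are those closer to 1 than to 0. For w = P this
  turns the half-plane condition into |1 - 1/P| < 1.\<close>

lemma half_plane_iff_cmod_less: "1 / 2 < Re w \<longleftrightarrow> cmod (w - 1) < cmod w"
proof -
  have "cmod (w - 1) < cmod w \<longleftrightarrow> (cmod (w - 1))\<^sup>2 < (cmod w)\<^sup>2"
    by (simp add: power_mono_iff flip: not_le)
  also have "\<dots> \<longleftrightarrow> 1 / 2 < Re w"
    unfolding cmod_power2 by (simp add: power2_eq_square algebra_simps)
  finally show ?thesis by simp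
qed

text \<open>This is the Schwarz lemma on a disk of radius \<open>r\<close>: \<omega>(z)/z, completed
  by \<omega>'(0) at the origin, is holomorphic, and the maximum principle carries the bound
  \<open>A / r\<close> from the circle to the disk.\<close>

lemma maximum_modulus_circle_linear_bound:
  assumes hol: "\<omega> holomorphic_on S" and S: "open S" "cball 0 r \<subseteq> S" and r: "0 < r" and "\<omega> 0 = 0"
    and bd: "\<And>z. cmod z = r \<Longrightarrow> cmod (\<omega> z) \<le> A" and "cmod z \<le> r"
  shows "cmod (\<omega> z) \<le> A * cmod z / r"
proof -
  define h where "h = (\<lambda>z. if z = 0 then deriv \<omega> 0 else (\<omega> z - \<omega> 0) / (z - 0))"
  have holh: "h holomorphic_on S"
    unfolding h_def using hol S r by (intro pole_lemma) (auto simp: interior_open)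
  have "cmod (h z) \<le> A / r"
  proof (rule maximum_modulus_frontier[of h "cball 0 r"])
    show "h holomorphic_on interior (cball 0 r)"
      using holh S by (rule_tac holomorphic_on_subset) auto
    show "continuous_on (closure (cball 0 r)) h"
      using holh S by (auto intro: holomorphic_on_imp_continuous_on holomorphic_on_subset)
    show "cmod (h z) \<le> A / r" if "z \<in> frontier (cball 0 r)" for z
      using that r bd[of z] \<open>\<omega> 0 = 0\<close> by (auto simp: h_def norm_divide divide_right_mono)
  qed (use assms in auto)
  moreover have "\<omega> z = h z * z"
    using \<open>\<omega> 0 = 0\<close> by (simp add: h_def)
  ultimately show ?thesis
    by (simp add: norm_mult mult_right_mono flip: times_divide_eq_left)
qed

text \<open>At a maximum of |\<omega>| on the circle the angular derivative of |\<omega>|^2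
  vanishes, which makes z0 \<omega>'(z0)/\<omega>(z0) real. The Schwarz bound |\<omega>(t z0)| \<le>
  A t along the radius makes its real part at least 1.\<close>

lemma Jack:
  assumes hol: "\<omega> holomorphic_on S" and S: "open S" "cball 0 r \<subseteq> S" and r: "0 < r" and "\<omega> 0 = 0"
    and z0: "cmod z0 = r" and mx: "\<And>z. cmod z = r \<Longrightarrow> cmod (\<omega> z) \<le> cmod (\<omega> z0)" and nz: "\<omega> z0 \<noteq> 0"
  obtains m where "m \<ge> 1" "z0 * deriv \<omega> z0 = of_real m * \<omega> z0"
proof -
  define A where "A = cmod (\<omega> z0)"
  \<comment> \<open>Up to the factor \<open>A\<^sup>2\<close> this is z0 \<omega>'(z0)/\<omega>(z0).
    Its real part governs the radial derivative of |\<omega>|^2, its imaginary part the angular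
    one.\<close>
  define N where "N = cnj (\<omega> z0) * (z0 * deriv \<omega> z0)"
  have "A > 0" using nz by (simp add: A_def)
  have "z0 \<in> S" using S z0 by auto
  have der: "(\<omega> has_field_derivative deriv \<omega> z0) (at z0)"
    using hol S(1) \<open>z0 \<in> S\<close> holomorphic_derivI by blast
  have "((\<lambda>t. (cmod (\<omega> (of_real t * z0)))\<^sup>2 - A\<^sup>2 * t\<^sup>2) has_real_derivative 2 * Re N - 2 * A\<^sup>2) (at 1)"
    using DERIV_diff[OF has_real_derivative_cmod_power2[OF has_vector_derivative_ray[OF der]]
        DERIV_cmult[OF DERIV_power[OF DERIV_ident, of 2], of "A\<^sup>2"]]
    by (simp add: N_def algebra_simps)
  then have "2 * Re N - 2 * A\<^sup>2 \<ge> 0"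
  proof (rule has_real_derivative_nonneg_at_right_end[of _ _ _ 0])
    fix t :: real assume t: "0 < t" "t < 1"
    have "cmod (\<omega> (of_real t * z0)) \<le> A * cmod (of_real t * z0) / r"
      by (rule maximum_modulus_circle_linear_bound[OF hol S r \<open>\<omega> 0 = 0\<close>])
        (use t z0 r mx in \<open>auto simp: A_def norm_mult mult_le_cancel_right1\<close>)
    then have "cmod (\<omega> (of_real t * z0)) \<le> A * t"
      using t z0 r by (simp add: norm_mult)
    then have "(cmod (\<omega> (of_real t * z0)))\<^sup>2 \<le> (A * t)\<^sup>2"
      by (intro power_mono) auto
    then show "(cmod (\<omega> (of_real t * z0)))\<^sup>2 - A\<^sup>2 * t\<^sup>2 \<le> (cmod (\<omega> (of_real 1 * z0)))\<^sup>2 - A\<^sup>2 * 1\<^sup>2"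
      by (simp add: A_def power_mult_distrib)
  qed simp
  then have re: "Re N \<ge> A\<^sup>2" by simp
  have "((\<lambda>t. z0 * cis t) has_vector_derivative z0 * \<i>) (at 0)"
    by (auto intro!: derivative_eq_intros simp: has_vector_derivative_def)
  then have "((\<lambda>t. \<omega> (z0 * cis t)) has_vector_derivative (z0 * \<i>) * deriv \<omega> z0) (at 0)"
    using field_vector_diff_chain_at[of "\<lambda>t. z0 * cis t" "z0 * \<i>" 0 \<omega> "deriv \<omega> z0"] der by (simp add: o_def)
  from has_real_derivative_cmod_power2[OF this]
  have "((\<lambda>t. (cmod (\<omega> (z0 * cis t)))\<^sup>2) has_real_derivative - 2 * Im N) (at 0)"
    by (simp add: N_def algebra_simps)
  then have "- 2 * Im N = 0"
  proof (rule DERIV_local_max[of _ _ _ 1])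
    show "\<forall>y. \<bar>0 - y\<bar> < 1 \<longrightarrow> (cmod (\<omega> (z0 * cis y)))\<^sup>2 \<le> (cmod (\<omega> (z0 * cis 0)))\<^sup>2"
      using mx z0 by (auto intro!: power_mono simp: norm_mult)
  qed simp
  then have "N = of_real (Re N)" by (simp add: complex_eq_iff)
  then have "\<omega> z0 * N = of_real (Re N) * \<omega> z0" by simp
  moreover have "\<omega> z0 * N = of_real (A\<^sup>2) * (z0 * deriv \<omega> z0)"
    unfolding N_def A_def by (simp only: mult.assoc[symmetric] complex_norm_square)
  ultimately have "of_real (A\<^sup>2) * (z0 * deriv \<omega> z0) = of_real (Re N) * \<omega> z0" by simp
  then have "z0 * deriv \<omega> z0 = of_real (Re N / A\<^sup>2) * \<omega> z0"
    using \<open>A > 0\<close> by (simp add: field_simps)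
  moreover have "Re N / A\<^sup>2 \<ge> 1" using re \<open>A > 0\<close> by simp
  ultimately show ?thesis using that by blast
qed

text \<open>The claim is |\<omega>| < 1 for \<omega> = 1 - 1/P. If it fails on some circle, Jack's
  lemma at a maximum z0 of |\<omega>| on that circle gives z0 P'/P = m (P - 1) with m \<ge> 1 and Re
  P \<le> 1/2, so 1 + 2 z0 P'/P has real part at most 1 - m \<le> 0.\<close>

lemma Re_gt_half_of_starlike_condition:
  assumes hol: "P holomorphic_on unit_disk" and nz: "\<And>z. z \<in> unit_disk \<Longrightarrow> P z \<noteq> 0" and "P 0 = 1"
    and star: "\<And>z. z \<in> unit_disk \<Longrightarrow> 0 < Re (1 + 2 * (z * deriv P z / P z))"
    and z: "z \<in> unit_disk"
  shows "1 / 2 < Re (P z)"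
proof (rule ccontr)
  assume neg: "\<not> ?thesis"
  define \<omega> where "\<omega> = (\<lambda>z. 1 - 1 / P z)"
  have hol\<omega>: "\<omega> holomorphic_on unit_disk"
    unfolding \<omega>_def using hol nz by (intro holomorphic_intros) auto
  have \<omega>P: "\<omega> w * P w = P w - 1" if "w \<in> unit_disk" for w
    using nz[OF that] by (simp add: \<omega>_def field_simps)
  have \<omega>1: "1 \<le> cmod (\<omega> w) \<longleftrightarrow> \<not> 1 / 2 < Re (P w)" if "w \<in> unit_disk" for w
  proof -
    have "cmod (\<omega> w) * cmod (P w) = cmod (P w - 1)"
      using \<omega>P[OF that] by (metis norm_mult)
    then show ?thesis
      unfolding half_plane_iff_cmod_less using nz[OF that]
      by (simp add: not_less mult_le_cancel_right1 flip: \<open>cmod (\<omega> w) * cmod (P w) = cmod (P w - 1)\<close>)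
  qed
  define r where "r = cmod z"
  have r: "0 < r" "r < 1"
    using neg \<open>P 0 = 1\<close> z by (auto simp: r_def)
  have sub: "cball 0 r \<subseteq> unit_disk" using r by auto
  have "\<exists>z0\<in>sphere 0 r. \<forall>w\<in>sphere 0 r. cmod (\<omega> w) \<le> cmod (\<omega> z0)"
    using r sub by (intro continuous_attains_sup continuous_intros
        holomorphic_on_imp_continuous_on holomorphic_on_subset[OF hol\<omega>]) auto
  then obtain z0 where z0: "cmod z0 = r" and mx: "\<And>w. cmod w = r \<Longrightarrow> cmod (\<omega> w) \<le> cmod (\<omega> z0)"
    by auto
  have "z0 \<in> unit_disk" using z0 r by simp
  have "1 \<le> cmod (\<omega> z0)"
    using \<omega>1[OF z] neg mx[of z] by (simp add: r_def)
  then have "\<omega> z0 \<noteq> 0" by auto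
  obtain m where "m \<ge> 1" and m: "z0 * deriv \<omega> z0 = of_real m * \<omega> z0"
    by (rule Jack[OF hol\<omega> open_ball sub r(1) _ z0 mx \<open>\<omega> z0 \<noteq> 0\<close>]) (auto simp: \<omega>_def \<open>P 0 = 1\<close>)
  have "(P has_field_derivative deriv P z0) (at z0)"
    using hol \<open>z0 \<in> unit_disk\<close> holomorphic_derivI open_ball by blast
  then have "(\<omega> has_field_derivative deriv P z0 / (P z0)\<^sup>2) (at z0)"
    unfolding \<omega>_def using nz[OF \<open>z0 \<in> unit_disk\<close>]
    by (auto intro!: derivative_eq_intros simp: power2_eq_square)
  then have "deriv \<omega> z0 = deriv P z0 / (P z0)\<^sup>2" by (rule DERIV_imp_deriv)
  then have "z0 * deriv P z0 / P z0 = (z0 * deriv \<omega> z0) * P z0"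
    using nz[OF \<open>z0 \<in> unit_disk\<close>] by (simp add: power2_eq_square)
  also have "\<dots> = of_real m * (P z0 - 1)"
    unfolding m using \<omega>P[OF \<open>z0 \<in> unit_disk\<close>] by (simp add: mult.assoc)
  finally have "0 < 1 + 2 * (m * (Re (P z0) - 1))"
    using star[OF \<open>z0 \<in> unit_disk\<close>] by simp
  moreover have "Re (P z0) \<le> 1 / 2"
    using \<omega>1[OF \<open>z0 \<in> unit_disk\<close>] \<open>1 \<le> cmod (\<omega> z0)\<close> by simp
  then have "m * (Re (P z0) - 1) \<le> m * (- 1 / 2)"
    using \<open>m \<ge> 1\<close> by (intro mult_left_mono) auto
  ultimately show False using \<open>m \<ge> 1\<close> by simp
qed

text \<open>At a zero of Re q the function |exp(-q)| would attain its maximum 1, so exp(-q) would be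
  constant, against Re q > 0 at \<open>c\<close>.\<close>

lemma Re_pos_of_Re_nonneg:
  assumes "q holomorphic_on S" "open S" "connected S" "c \<in> S" "0 < Re (q c)"
    and "\<And>z. z \<in> S \<Longrightarrow> 0 \<le> Re (q z)" "z \<in> S"
  shows "0 < Re (q z)"
proof (rule ccontr)
  assume neg: "\<not> ?thesis"
  then have "(\<lambda>z. exp (- q z)) constant_on S"
    using assms by (intro maximum_modulus_principle[of _ S S z] holomorphic_intros) fastforce+
  then have "exp (- q c) = exp (- q z)"
    using assms unfolding constant_on_def by metis
  then have "cmod (exp (- q c)) = cmod (exp (- q z))" by simp
  then show False using assms neg by simp
qed

section \<open>Starlike and close-to-convex functions\<close>

text \<open>The coefficients at 0 and 1 are written out because the given series starts at index 2.
  The result opens the way to formal power series and their uniqueness.\<close>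

lemma has_normalized_expansion_imp_has_fps_expansion:
  assumes "has_normalized_expansion f a"
  shows "f has_fps_expansion Abs_fps (\<lambda>k. if k = 0 then 0 else if k = 1 then 1 else a k)"
    (is "_ has_fps_expansion ?F")
proof (rule has_fps_expansionI)
  have "(\<lambda>k. fps_nth ?F k * z ^ k) sums f z" if "z \<in> unit_disk" for z
  proof -
    have "(\<lambda>k. fps_nth ?F (k + 2) * z ^ (k + 2)) sums (f z - (\<Sum>k<2. fps_nth ?F k * z ^ k))"
      using assms that by (simp add: has_normalized_expansion_def numeral_2_eq_2)
    then show ?thesis by (subst (asm) sums_iff_shift')
  qed
  then show "\<forall>\<^sub>F z in nhds 0. (\<lambda>k. fps_nth ?F k * z ^ k) sums f z"
    by (intro eventually_mono[OF eventually_nhds_in_open[of unit_disk 0]]) auto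
qed

lemma normalized_analytic_at_0:
  assumes "f \<in> normalized_analytic"
  shows "f 0 = 0" "deriv f 0 = 1"
proof -
  obtain a where "has_normalized_expansion f a"
    using assms by (auto simp: normalized_analytic_def)
  note F = fps_nth_fps_expansion[OF has_normalized_expansion_imp_has_fps_expansion[OF this]]
  show "f 0 = 0" "deriv f 0 = 1" using F[of 0] F[of 1] by simp_all
qed

lemma class_S_starD:
  assumes "g \<in> class_S_star"
  shows "g holomorphic_on unit_disk" "inj_on g unit_disk" "g 0 = 0" "deriv g 0 = 1"
    "\<And>w. w \<in> g ` unit_disk \<Longrightarrow> closed_segment 0 w \<subseteq> g ` unit_disk"
  using assms normalized_analytic_at_0[of g]
  by (auto simp: class_S_star_def class_S_def normalized_analytic_def starlike_wrt_def)

text \<open>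
  By the Schwarz lemma \<open>|g\<^sup>-\<^sup>1(t g(z))| \<le> |z|\<close> for \<open>0 < t \<le> 1\<close>, so the derivative of the left-hand
  side at \<open>t = 1\<close> is nonnegative.
\<close>

lemma starlike_Re_nonneg:
  assumes g: "g \<in> class_S_star" and z: "z \<in> unit_disk" "z \<noteq> 0"
  shows "0 \<le> Re (z * deriv g z / g z)"
proof -
  note g = class_S_starD[OF g]
  obtain k where holk: "k holomorphic_on g ` unit_disk"
    and dk: "\<And>z. z \<in> unit_disk \<Longrightarrow> deriv g z * deriv k (g z) = 1"
    and k: "\<And>z. z \<in> unit_disk \<Longrightarrow> k (g z) = z"
    using holomorphic_has_inverse[OF g(1) _ g(2)] by auto
  have "open (g ` unit_disk)"
    using open_mapping_thm3[OF g(1) _ g(2)] by simp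
  then have "(k has_field_derivative deriv k (g z)) (at (g z))"
    using holk z holomorphic_derivI by blast
  from has_real_derivative_cmod_power2[OF has_vector_derivative_ray[OF this]]
  have "((\<lambda>t. (cmod (k (of_real t * g z)))\<^sup>2) has_real_derivative 2 * Re (cnj z * (g z * deriv k (g z)))) (at 1)"
    using k[OF z(1)] by simp
  then have "0 \<le> 2 * Re (cnj z * (g z * deriv k (g z)))"
  proof (rule has_real_derivative_nonneg_at_right_end[of _ _ _ 0])
    fix t :: real assume t: "0 < t" "t < 1"
    have sub: "of_real t * w \<in> g ` unit_disk" if "w \<in> g ` unit_disk" for w
    proof -
      have "of_real t * w = (1 - t) *\<^sub>R 0 + t *\<^sub>R w" by (simp add: scaleR_conv_of_real)
      then have "of_real t * w \<in> closed_segment 0 w" using t unfolding closed_segment_def by fastforce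
      then show ?thesis using g(5)[OF that] by blast
    qed
    have "cmod (k (of_real t * g z)) \<le> cmod z"
    proof (rule Schwarz_Lemma(1)[of "\<lambda>z. k (of_real t * g z)"])
      have "k \<circ> (\<lambda>z. of_real t * g z) holomorphic_on unit_disk"
        using sub by (intro holomorphic_on_compose_gen[OF _ holk] holomorphic_intros g(1)) auto
      then show "(\<lambda>z. k (of_real t * g z)) holomorphic_on unit_disk" by (simp add: o_def)
      show "cmod (k (of_real t * g w)) < 1" if "cmod w < 1" for w
        using sub[of "g w"] that k by auto
    qed (use z k[of 0] g(3) in auto)
    then show "(cmod (k (of_real t * g z)))\<^sup>2 \<le> (cmod (k (of_real 1 * g z)))\<^sup>2"
      using k[OF z(1)] by (auto intro: power_mono)
  qed simp
  moreover have "deriv g z \<noteq> 0" "deriv k (g z) = 1 / deriv g z"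
    using dk[OF z(1)] by (auto simp: eq_divide_eq mult.commute)
  \<comment> \<open>\<open>v\<close> is the reciprocal of the wanted quotient, since the derivative
    of the inverse function is 1/g'. Taking reciprocals preserves the sign of the real part.\<close>
  moreover define v where "v = g z / (z * deriv g z)"
  have "cnj z * (g z * (1 / deriv g z)) = of_real ((cmod z)\<^sup>2) * v"
    unfolding complex_norm_square v_def using z by (simp add: field_simps)
  ultimately have "0 \<le> Re (of_real ((cmod z)\<^sup>2) * v)" by simp
  then have "0 \<le> Re v"
    using z by (simp add: zero_le_mult_iff)
  then have "0 \<le> Re (inverse v)" by simp
  moreover have "inverse v = z * deriv g z / g z" by (simp add: v_def)
  ultimately show ?thesis by simp
qed

text \<open>The quotient g(z)/z, with value 1 at the origin, has no zeros, so it has a holomorphic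
  square root P. Then z g'/g = 1 + 2 z P'/P, and the half-plane bound follows from the starlike
  condition.\<close>

lemma starlike_square_root:
  assumes "g \<in> class_S_star"
  obtains P where "P holomorphic_on unit_disk" "P 0 = 1" "\<And>z. z \<in> unit_disk \<Longrightarrow> 1 / 2 < Re (P z)"
    "\<And>z. z \<in> unit_disk \<Longrightarrow> g z = z * (P z)\<^sup>2"
proof -
  note g = class_S_starD[OF assms]
  define G where "G = (\<lambda>z. if z = 0 then deriv g 0 else (g z - g 0) / (z - 0))"
  have gz: "g z \<noteq> 0" if "z \<in> unit_disk" "z \<noteq> 0" for z
    using inj_onD[OF g(2), of z 0] that g(3) by auto
  have "G holomorphic_on unit_disk"
    unfolding G_def by (intro pole_lemma_open g) auto
  moreover have "G z \<noteq> 0" if "z \<in> unit_disk" for z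
    using gz[OF that] g by (simp add: G_def)
  ultimately obtain P0 where P0: "P0 holomorphic_on unit_disk" "\<And>z. z \<in> unit_disk \<Longrightarrow> G z = (P0 z)\<^sup>2"
    using contractible_imp_holomorphic_sqrt[of G unit_disk] convex_imp_contractible[OF convex_ball] by metis
  \<comment> \<open>Since \<open>P0 0\<close> is 1 or -1, this factor only corrects the sign, so
    that P(0) = 1.\<close>
  define P where "P = (\<lambda>z. P0 0 * P0 z)"
  have "(P0 0)\<^sup>2 = 1"
    using P0(2)[of 0] g by (simp add: G_def)
  then have hol: "P holomorphic_on unit_disk" and "P 0 = 1" and PG: "\<And>z. z \<in> unit_disk \<Longrightarrow> G z = (P z)\<^sup>2"
    using P0 by (auto simp: P_def power_mult_distrib intro!: holomorphic_intros) (simp add: power2_eq_square)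
  have gP: "g z = z * (P z)\<^sup>2" if "z \<in> unit_disk" for z
    using PG[OF that] g(3) by (auto simp: G_def divide_simps split: if_splits)
  have Pnz: "P z \<noteq> 0" if "z \<in> unit_disk" for z
    using gz[OF that] gP[OF that] \<open>P 0 = 1\<close> by (cases "z = 0") auto
  define q where "q = (\<lambda>z. 1 + 2 * (z * deriv P z / P z))"
  \<comment> \<open>Strict positivity comes from the value 1 at the origin and the maximum
    principle.\<close>
  have q: "0 < Re (q z)" if "z \<in> unit_disk" for z
  proof (rule Re_pos_of_Re_nonneg[of q unit_disk 0])
    show "q holomorphic_on unit_disk"
      unfolding q_def using Pnz hol by (intro holomorphic_intros) auto
    show "0 \<le> Re (q z)" if "z \<in> unit_disk" for z
    proof (cases "z = 0")
      case False
      have "(P has_field_derivative deriv P z) (at z)"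
        using hol that holomorphic_derivI open_ball by blast
      then have "((\<lambda>z. z * (P z)\<^sup>2) has_field_derivative (P z)\<^sup>2 + z * (2 * P z * deriv P z)) (at z)"
        by (auto intro!: derivative_eq_intros)
      then have "(g has_field_derivative (P z)\<^sup>2 + z * (2 * P z * deriv P z)) (at z)"
        by (rule has_field_derivative_transform_within_open[of _ _ _ unit_disk]) (use gP that in auto)
      then have "deriv g z = (P z)\<^sup>2 + z * (2 * P z * deriv P z)" by (rule DERIV_imp_deriv)
      then have "z * deriv g z / g z = q z"
        unfolding q_def gP[OF that] using False Pnz[OF that] by (simp add: power2_eq_square field_simps)
      then show ?thesis using starlike_Re_nonneg[OF assms that False] by simp
    qed (simp add: q_def)
  qed (use that in \<open>auto simp: q_def\<close>)
  have "1 / 2 < Re (P z)" if "z \<in> unit_disk" for z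
    using Re_gt_half_of_starlike_condition[OF hol Pnz \<open>P 0 = 1\<close> _ that] q unfolding q_def by blast
  then show ?thesis using that hol \<open>P 0 = 1\<close> gP by blast
qed

text \<open>
  With \<open>h = e\<^bsup>i\<theta>\<^esup> z f'(z) / g(z)\<close>, the function \<open>Q\<close> is the affine normalization of \<open>h\<close> to \<open>Re Q > 1/2\<close>,
  \<open>Q(0) = 1\<close>, and \<open>c = e\<^bsup>-2i\<theta>\<^esup>\<close>.
\<close>

lemma close_to_convex_factorization:
  assumes "f \<in> close_to_convex"
  obtains P Q c where "P holomorphic_on unit_disk" "P 0 = 1" "\<And>z. z \<in> unit_disk \<Longrightarrow> 1 / 2 < Re (P z)"
    "Q holomorphic_on unit_disk" "Q 0 = 1" "\<And>z. z \<in> unit_disk \<Longrightarrow> 1 / 2 < Re (Q z)" "cmod c = 1"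
    "\<And>z. z \<in> unit_disk \<Longrightarrow> deriv f z = (P z)\<^sup>2 * (- c + (1 + c) * Q z)"
proof -
  obtain \<theta> g where f: "f \<in> normalized_analytic" and g: "g \<in> class_S_star"
    and h0: "\<And>z. z \<in> unit_disk \<Longrightarrow> 0 < Re (exp (\<i> * of_real \<theta>) * ctc_quotient f g z)"
    using assms unfolding close_to_convex_def by blast
  obtain P where P: "P holomorphic_on unit_disk" "P 0 = 1" "\<And>z. z \<in> unit_disk \<Longrightarrow> 1 / 2 < Re (P z)"
    and gP: "\<And>z. z \<in> unit_disk \<Longrightarrow> g z = z * (P z)\<^sup>2"
    using starlike_square_root[OF g] by metis
  have Pnz: "P z \<noteq> 0" if "z \<in> unit_disk" for z
    using P(3)[OF that] by auto
  have holf: "f holomorphic_on unit_disk" using f by (simp add: normalized_analytic_def)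
  define h where "h = (\<lambda>z. cis \<theta> * (deriv f z / (P z)\<^sup>2))"
  have h: "0 < Re (h z)" if "z \<in> unit_disk" for z
  proof -
    have "ctc_quotient f g z = deriv f z / (P z)\<^sup>2"
      using normalized_analytic_at_0[OF f] P(2) gP[OF that] by (simp add: ctc_quotient_def)
    then show ?thesis using h0[OF that] by (simp add: h_def cis_conv_exp)
  qed
  have "h 0 = cis \<theta>"
    using normalized_analytic_at_0[OF f] P(2) by (simp add: h_def)
  \<comment> \<open>The value 1 filled in for the quotient at the origin is what forces
    \<open>cos \<theta>\<close> to be positive; this permits the division in
    \<open>Q\<close>.\<close>
  then have "0 < cos \<theta>" using h[of 0] by simp
  define Q where "Q = (\<lambda>z. 1 / 2 + (h z - \<i> * sin \<theta>) / (2 * cos \<theta>))"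
  define c where "c = cis (- 2 * \<theta>)"
  have "cis \<theta> + cis (- \<theta>) = of_real (2 * cos \<theta>)" by (simp add: complex_eq_iff)
  moreover have "1 + c = cis (- \<theta>) * (cis \<theta> + cis (- \<theta>))"
    by (simp add: c_def cis_mult distrib_left)
  ultimately have c: "1 + c = cis (- \<theta>) * of_real (2 * cos \<theta>)" by simp
  show ?thesis
  proof (rule that[OF P])
    show "Q holomorphic_on unit_disk"
      unfolding Q_def h_def using Pnz \<open>0 < cos \<theta>\<close> by (intro holomorphic_intros holf P) auto
    show "Q 0 = 1"
      unfolding Q_def \<open>h 0 = cis \<theta>\<close> using \<open>0 < cos \<theta>\<close> by (simp add: complex_eq_iff)
    show "1 / 2 < Re (Q z)" if "z \<in> unit_disk" for z
      using h[OF that] \<open>0 < cos \<theta>\<close> by (simp add: Q_def)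
    show "cmod c = 1" by (simp add: c_def)
    show "deriv f z = (P z)\<^sup>2 * (- c + (1 + c) * Q z)" if "z \<in> unit_disk" for z
    proof -
      have "h z - cis \<theta> = of_real (2 * cos \<theta>) * (Q z - 1)"
        using \<open>0 < cos \<theta>\<close> by (simp add: Q_def field_simps complex_eq_iff)
      then have "(1 + c) * (Q z - 1) = cis (- \<theta>) * (h z - cis \<theta>)"
        unfolding c by simp
      also have "\<dots> = deriv f z / (P z)\<^sup>2 - 1"
        by (simp add: h_def right_diff_distrib cis_mult flip: mult.assoc)
      finally have "- c + (1 + c) * Q z = deriv f z / (P z)\<^sup>2"
        by (simp add: algebra_simps)
      then show ?thesis using Pnz[OF that] by simp
    qed
  qed
qed

section \<open>Averages of Cauchy kernels\<close>

text \<open>Cauchy's coefficient formula on |u| = r, parametrized by the angle and read as a Fourier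
  coefficient.\<close>

lemma fps_nth_has_integral_circle:
  fixes f :: "complex \<Rightarrow> complex" and r :: real
  assumes "f holomorphic_on ball 0 1" "f has_fps_expansion F" "0 < r" "r < 1"
  shows "((\<lambda>t. f (r * cis t) * cis (- (real k * t))) has_integral 2 * pi * r ^ k * fps_nth F k) {0..2 * pi}"
proof -
  have "((\<lambda>u. f u / (u - 0) ^ Suc k) has_contour_integral (2 * pi * \<i>) / fact k * (deriv ^^ k) f 0) (circlepath 0 r)"
    using assms by (intro Cauchy_has_contour_integral_higher_derivative_circlepath
        holomorphic_on_imp_continuous_on holomorphic_on_subset[OF assms(1)]) auto
  then have "((\<lambda>u. f u / u ^ Suc k) has_contour_integral 2 * pi * \<i> * fps_nth F k) (part_circlepath 0 r 0 (2 * pi))"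
    using fps_nth_fps_expansion[OF assms(2), of k] by (simp add: circlepath_def)
  then have "((\<lambda>t. f (0 + r * cis t) / (0 + r * cis t) ^ Suc k * r * \<i> * cis t) has_integral 2 * pi * \<i> * fps_nth F k) {0..2 * pi}"
    by (subst (asm) has_contour_integral_part_circlepath_iff) auto
  from has_integral_mult_right[OF this, of "r ^ k / \<i>"]
  have I: "((\<lambda>t. r ^ k / \<i> * (f (0 + r * cis t) / (0 + r * cis t) ^ Suc k * r * \<i> * cis t)) has_integral 2 * pi * r ^ k * fps_nth F k) {0..2 * pi}"
    by (simp add: mult_ac)
  have "r ^ k / \<i> * (f (0 + r * cis t) / (0 + r * cis t) ^ Suc k * r * \<i> * cis t) = f (r * cis t) * cis (- (real k * t))" for t
  proof -
    have "cis t ^ Suc k * cis (- (real k * t)) = cis t"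
      by (simp only: Complex.DeMoivre cis_mult) (simp add: algebra_simps)
    then have "cis t / cis t ^ Suc k = cis (- (real k * t))"
      by (metis cis_neq_zero nonzero_mult_div_cancel_left power_not_zero)
    moreover have "r ^ k / \<i> * (f (0 + r * cis t) / (0 + r * cis t) ^ Suc k * r * \<i> * cis t) = f (r * cis t) * (cis t / cis t ^ Suc k)"
      using \<open>0 < r\<close> by (simp add: power_mult_distrib field_simps)
    ultimately show ?thesis by simp
  qed
  with I show ?thesis by simp
qed

text \<open>These integrals are, up to scaling, the constant coefficient of z^k f(z). After
  conjugation they show what the conjugate of P contributes to the coefficients.\<close>

lemma has_integral_circle_nonneg_frequency:
  fixes f :: "complex \<Rightarrow> complex" and r :: real
  assumes "f holomorphic_on ball 0 1" "0 < r" "r < 1"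
  shows "((\<lambda>t. f (r * cis t) * cis (real k * t)) has_integral (if k = 0 then 2 * pi * f 0 else 0)) {0..2 * pi}"
proof -
  have exp: "(\<lambda>z. z ^ k * f z) has_fps_expansion fps_X ^ k * fps_expansion f 0"
    by (intro fps_expansion_intros has_fps_expansion_fps_expansion[OF open_ball _ assms(1)]) auto
  have "((\<lambda>t. (r * cis t) ^ k * f (r * cis t) * cis (- (real 0 * t))) has_integral
      2 * pi * r ^ 0 * fps_nth (fps_X ^ k * fps_expansion f 0) 0) {0..2 * pi}"
    using assms exp by (intro fps_nth_has_integral_circle holomorphic_intros) auto
  from has_integral_mult_right[OF this, of "1 / r ^ k"]
  have "((\<lambda>t. 1 / r ^ k * ((r * cis t) ^ k * f (r * cis t))) has_integral 
     1 / r ^ k * (2 * pi * fps_nth (fps_X ^ k * fps_expansion f 0) 0)) {0..2 * pi}"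
    by simp
  moreover have "1 / of_real (r ^ k) * ((r * cis t) ^ k * f (r * cis t)) = f (r * cis t) * cis (real k * t)" for t
    using \<open>0 < r\<close> by (simp add: power_mult_distrib Complex.DeMoivre)
  ultimately show ?thesis by (cases "k = 0") (simp_all add: fps_expansion_def fps_X_power_mult_nth)
qed

text \<open>Write 2 Re P - 1 = P + cnj P - 1. The conjugate part has no Fourier coefficient of
  positive index, and at index 0 it cancels against 1 because P(0) = 1.\<close>

lemma fps_nth_eq_half_plane_average:
  fixes P :: "complex \<Rightarrow> complex" and r :: real
  assumes P: "P holomorphic_on ball 0 1" "P has_fps_expansion F" "P 0 = 1" and r: "0 < r" "r < 1"
  shows "((\<lambda>t. of_real (2 * Re (P (r * cis t)) - 1) * cis (- t) ^ k) has_integral 2 * pi * r ^ k * fps_nth F k) {0..2 * pi}"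
proof -
  have "((\<lambda>t. cnj (P (r * cis t) * cis (real k * t))) has_integral cnj (if k = 0 then 2 * pi * P 0 else 0)) {0..2 * pi}"
    using has_integral_linear[OF has_integral_circle_nonneg_frequency[OF P(1) r] bounded_linear_cnj]
    by (simp only: o_def)
  moreover have "((\<lambda>t. cnj (1 * cis (real k * t))) has_integral cnj (if k = 0 then complex_of_real (2 * pi) * 1 else 0)) {0..2 * pi}"
    using has_integral_linear[OF has_integral_circle_nonneg_frequency[of "\<lambda>_. 1", OF _ r] bounded_linear_cnj]
    by (simp only: o_def holomorphic_on_const)
  ultimately have "((\<lambda>t. P (r * cis t) * cis (- (real k * t)) + (cnj (P (r * cis t) * cis (real k * t)) - cnj (1 * cis (real k * t))))
      has_integral 2 * pi * r ^ k * fps_nth F k + (cnj (if k = 0 then 2 * pi * P 0 else 0) - cnj (if k = 0 then complex_of_real (2 * pi) * 1 else 0))) {0..2 * pi}"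
    by (intro has_integral_add has_integral_diff fps_nth_has_integral_circle P r)
  moreover have "P (r * cis t) * cis (- (real k * t)) + (cnj (P (r * cis t) * cis (real k * t)) - cnj (1 * cis (real k * t)))
      = of_real (2 * Re (P (r * cis t)) - 1) * cis (- t) ^ k" for t
  proof -
    have "of_real (2 * Re (P (r * cis t)) - 1) = P (r * cis t) + cnj (P (r * cis t)) - 1"
      by (simp add: complex_eq_iff)
    then show ?thesis by (simp add: Complex.DeMoivre cis_cnj algebra_simps)
  qed
  moreover have "cnj (if k = 0 then complex_of_real (2 * pi) * P 0 else 0)
      - cnj (if k = 0 then complex_of_real (2 * pi) * 1 else 0) = 0"
    using P(3) by simp
  ultimately show ?thesis by (simp only: add_0_right)
qed

text \<open>
  A Herglotz representation in dual form: \<open>P\<close> is an average of the kernels \<open>1/(1 - \<eta>z)\<close>, \<open>|\<eta>| = 1\<close>.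
\<close>

lemma half_plane_functional_bound:
  fixes P :: "complex \<Rightarrow> complex"
  assumes P: "P holomorphic_on ball 0 1" "P has_fps_expansion F" "P 0 = 1"
    and re: "\<And>z. z \<in> ball 0 1 \<Longrightarrow> 1 / 2 < Re (P z)"
    and bd: "\<And>\<eta>. cmod \<eta> = 1 \<Longrightarrow> Re (\<Sum>k\<le>N. d k * \<eta> ^ k) \<le> M"
  shows "Re (\<Sum>k\<le>N. d k * fps_nth F k) \<le> M"
proof -
  have le: "Re (\<Sum>k\<le>N. d k * (of_real r ^ k * fps_nth F k)) \<le> M" if r: "0 < r" "r < 1" for r :: real
  proof -
    \<comment> \<open>The averaging density: nonnegative since Re P > 1/2, and of total mass
      \<open>2 * pi\<close> by the coefficient formula at index 0.\<close>
    define \<rho> where "\<rho> = (\<lambda>t. 2 * Re (P (r * cis t)) - 1)"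
    have \<rho>0: "\<rho> t \<ge> 0" for t
      using re[of "r * cis t"] r by (simp add: \<rho>_def norm_mult)
    have I: "((\<lambda>t. of_real (\<rho> t) * cis (- t) ^ k) has_integral 2 * of_real pi * of_real r ^ k * fps_nth F k) {0..2 * pi}" for k
      using fps_nth_eq_half_plane_average[OF P r, of k] by (simp add: \<rho>_def)
    have "((\<lambda>t. \<Sum>k\<le>N. d k * (of_real (\<rho> t) * cis (- t) ^ k)) has_integral
        (\<Sum>k\<le>N. d k * (2 * pi * r ^ k * fps_nth F k))) {0..2 * pi}"
      using I by (intro has_integral_sum has_integral_mult_right) auto
    from has_integral_linear[OF this bounded_linear_Re]
    have "((\<lambda>t. Re (\<Sum>k\<le>N. d k * (of_real (\<rho> t) * cis (- t) ^ k))) has_integral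
        Re (\<Sum>k\<le>N. d k * (2 * pi * r ^ k * fps_nth F k))) {0..2 * pi}" by (simp only: o_def)
    moreover have "((\<lambda>t. \<rho> t * M) has_integral (2 * pi) * M) {0..2 * pi}"
    proof -
      have "F $ 0 = 1" using fps_nth_fps_expansion[OF P(2), of 0] P(3) by simp
      then have "((\<lambda>t. of_real (\<rho> t)) has_integral complex_of_real (2 * pi)) {0..2 * pi}"
        using I[of 0] by simp
      from has_integral_linear[OF this bounded_linear_Re]
      have "(\<rho> has_integral 2 * pi) {0..2 * pi}" by (simp add: o_def)
      then show ?thesis by (rule has_integral_mult_left)
    qed
    ultimately have "Re (\<Sum>k\<le>N. d k * (2 * pi * r ^ k * fps_nth F k)) \<le> 2 * pi * M"
    proof (rule has_integral_le)
      fix t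
      have "(\<Sum>k\<le>N. d k * (of_real (\<rho> t) * cis (- t) ^ k)) = of_real (\<rho> t) * (\<Sum>k\<le>N. d k * cis (- t) ^ k)"
        by (simp add: sum_distrib_left mult_ac)
      then show "Re (\<Sum>k\<le>N. d k * (of_real (\<rho> t) * cis (- t) ^ k)) \<le> \<rho> t * M"
        using bd[of "cis (- t)"] \<rho>0[of t] by (simp add: mult_left_mono)
    qed
    also have "(\<Sum>k\<le>N. d k * (2 * pi * r ^ k * fps_nth F k)) = of_real (2 * pi) * (\<Sum>k\<le>N. d k * (of_real r ^ k * fps_nth F k))"
      by (simp add: sum_distrib_left mult_ac)
    finally have "2 * pi * Re (\<Sum>k\<le>N. d k * (of_real r ^ k * fps_nth F k)) \<le> 2 * pi * M"
      by (simp only: times_complex.sel Re_complex_of_real Im_complex_of_real mult_zero_left diff_zero)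
    then show ?thesis by simp
  qed
  \<comment> \<open>The functional involves finitely many coefficients, so it is continuous in
    \<open>r\<close> and the bound survives as \<open>r\<close> tends to 1.\<close>
  have "((\<lambda>r. Re (\<Sum>k\<le>N. d k * (of_real r ^ k * fps_nth F k))) \<longlongrightarrow> Re (\<Sum>k\<le>N. d k * (of_real 1 ^ k * fps_nth F k))) (at_left 1)"
    by (intro tendsto_intros)
  then have "Re (\<Sum>k\<le>N. d k * (of_real 1 ^ k * fps_nth F k)) \<le> M"
  proof (rule tendsto_upperbound)
    show "\<forall>\<^sub>F r in at_left 1. Re (\<Sum>k\<le>N. d k * (of_real r ^ k * fps_nth F k)) \<le> M"
      by (rule eventually_mono[OF eventually_at_left_real[of 0 1]]) (use le in auto)
  qed simp
  then show ?thesis by simp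
qed

section \<open>Feynman's parametrization and functionals of products of kernels\<close>

lemma has_integral_Beta_fact:
  "((\<lambda>s::real. s ^ i * (1 - s) ^ j) has_integral fact i * fact j / fact (i + j + 1)) {0..1}"
proof -
  have "((\<lambda>t. t powr (real (i + 1) - 1) * (1 - t) powr (real (j + 1) - 1)) has_integral Beta (real (i + 1)) (real (j + 1))) {0<..<1}"
    using has_integral_Beta_real[of "real (i + 1)" "real (j + 1)"] by (simp add: has_integral_Icc_iff_Ioo)
  moreover have "Beta (real (i + 1)) (real (j + 1)) = fact i * fact j / fact (i + j + 1)"
    using Gamma_fact[of "i + j + 1", where 'a = real] Gamma_fact[of i, where 'a = real] Gamma_fact[of j, where 'a = real]
    by (simp add: Beta_def algebra_simps)
  ultimately have "((\<lambda>s::real. s ^ i * (1 - s) ^ j) has_integral fact i * fact j / fact (i + j + 1)) {0<..<1}"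
    by (subst has_integral_cong[where g = "\<lambda>t. t powr (real (i + 1) - 1) * (1 - t) powr (real (j + 1) - 1)"])
      (auto simp: powr_realpow)
  then show ?thesis by (simp add: has_integral_Icc_iff_Ioo)
qed

text \<open>The expansion of \<open>1 / (1 - w z)\<^bsup>q+1\<^esup>\<close>.\<close>

definition kernel_fps :: "nat \<Rightarrow> complex \<Rightarrow> complex fps" where
  "kernel_fps q w = Abs_fps (\<lambda>m. of_nat ((m + q) choose q) * w ^ m)"

text \<open>
  Feynman's parametrization
  \<open>1/((1 - yz)(1 - wz)\<^bsup>q+1\<^esup>) = \<integral>\<^sub>0\<^sup>1 (q + 1)(1 - s)\<^sup>q / (1 - (sy + (1 - s)w)z)\<^bsup>q+2\<^esup> ds\<close>, coefficientwise.
\<close>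

lemma Feynman_parametrization:
  "((\<lambda>s::real. of_real (real (q + 1) * (1 - s) ^ q) * fps_nth (kernel_fps (q + 1) (of_real s * y + of_real (1 - s) * w)) m)
      has_integral fps_nth (kernel_fps 0 y * kernel_fps q w) m) {0..1}"
proof -
  \<comment> \<open>The part of the binomial expansion of (s y + (1 - s) w)^m that does not depend
    on \<open>s\<close>; the powers of \<open>s\<close> and \<open>1 - s\<close> are left to the
    Beta integral.\<close>
  define C where "C = (\<lambda>i. complex_of_nat (((m + (q + 1)) choose (q + 1)) * (m choose i)) * of_nat (q + 1) * y ^ i * w ^ (m - i))"
  have "((\<lambda>s::real. \<Sum>i\<le>m. C i * of_real (s ^ i * (1 - s) ^ (m - i + q))) has_integral
      (\<Sum>i\<le>m. C i * of_real (fact i * fact (m - i + q) / fact (i + (m - i + q) + 1)))) {0..1}"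
    by (intro has_integral_sum has_integral_mult_right has_integral_of_real has_integral_Beta_fact) auto
  also have "(\<lambda>s::real. \<Sum>i\<le>m. C i * of_real (s ^ i * (1 - s) ^ (m - i + q)))
      = (\<lambda>s::real. of_real (real (q + 1) * (1 - s) ^ q) * fps_nth (kernel_fps (q + 1) (of_real s * y + of_real (1 - s) * w)) m)"
  proof
    fix s :: real
    have "C i * of_real (s ^ i * (1 - s) ^ (m - i + q)) = of_real (real (q + 1) * (1 - s) ^ q) *
        (of_nat ((m + (q + 1)) choose (q + 1)) *
          (of_nat (m choose i) * (of_real s * y) ^ i * (of_real (1 - s) * w) ^ (m - i)))" for i
      by (simp only: C_def power_mult_distrib power_add of_real_mult of_real_power of_nat_mult of_real_of_nat_eq mult_ac)
    then show "(\<Sum>i\<le>m. C i * of_real (s ^ i * (1 - s) ^ (m - i + q)))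
      = of_real (real (q + 1) * (1 - s) ^ q) * fps_nth (kernel_fps (q + 1) (of_real s * y + of_real (1 - s) * w)) m"
      by (simp only: kernel_fps_def fps_nth_Abs_fps binomial_ring sum_distrib_left)
  qed
  also have "(\<Sum>i\<le>m. C i * of_real (fact i * fact (m - i + q) / fact (i + (m - i + q) + 1)))
      = (\<Sum>i\<le>m. y ^ i * (of_nat ((m - i + q) choose q) * w ^ (m - i)))"
  proof (rule sum.cong[OF refl])
    fix i assume "i \<in> {..m}"
    then have "i \<le> m" by simp
    have "real (((m + (q + 1)) choose (q + 1)) * (m choose i)) * real (q + 1) * (fact i * fact (m - i + q) / fact (i + (m - i + q) + 1))
        = real ((m - i + q) choose q)"
    proof -
      have "real ((m + (q + 1)) choose (q + 1)) = fact (m + q + 1) / ((q + 1) * fact q * fact m)"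
        by (subst binomial_fact) (simp_all add: algebra_simps)
      moreover have "real (m choose i) = fact m / (fact i * fact (m - i))"
        using \<open>i \<le> m\<close> by (rule binomial_fact)
      moreover have "real ((m - i + q) choose q) = fact (m - i + q) / (fact q * fact (m - i))"
        by (subst binomial_fact) simp_all
      moreover have "i + (m - i + q) + 1 = m + q + 1" using \<open>i \<le> m\<close> by simp
      moreover have "A / (p * B * C) * (C / (D * E)) * p * (D * G / A) = G / (B * E)"
        if "A \<noteq> 0" "p \<noteq> 0" "C \<noteq> 0" "D \<noteq> 0" for A B C D E G p :: real
        using that by simp
      ultimately show ?thesis by (simp only: of_nat_mult) (simp del: fact_Suc)
    qed
    then have "complex_of_real (real (((m + (q + 1)) choose (q + 1)) * (m choose i)) * real (q + 1) * (fact i * fact (m - i + q) / fact (i + (m - i + q) + 1)))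
        = complex_of_real (real ((m - i + q) choose q))" by (rule arg_cong)
    then have "of_nat (((m + (q + 1)) choose (q + 1)) * (m choose i)) * of_nat (q + 1) * complex_of_real (fact i * fact (m - i + q) / fact (i + (m - i + q) + 1)) = of_nat ((m - i + q) choose q)"
      by (simp only: of_real_mult of_real_of_nat_eq)
    moreover have "C i * complex_of_real (fact i * fact (m - i + q) / fact (i + (m - i + q) + 1)) = (of_nat (((m + (q + 1)) choose (q + 1)) * (m choose i)) * of_nat (q + 1) * complex_of_real (fact i * fact (m - i + q) / fact (i + (m - i + q) + 1))) * (y ^ i * w ^ (m - i))"
      by (simp only: C_def mult_ac)
    ultimately show "C i * complex_of_real (fact i * fact (m - i + q) / fact (i + (m - i + q) + 1)) = y ^ i * (of_nat ((m - i + q) choose q) * w ^ (m - i))"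
      by (simp only: mult_ac)
  qed
  also have "\<dots> = fps_nth (kernel_fps 0 y * kernel_fps q w) m"
    by (simp add: kernel_fps_def fps_mult_nth atLeast0AtMost)
  finally show ?thesis .
qed

text \<open>Multiplication by \<open>U\<close> is triangular on coefficients, so it can be absorbed
  into the functional. This lets the factors of a product be replaced one at a time.\<close>

lemma fps_functional_mult:
  fixes U :: "complex fps"
  obtains e where "\<And>F. (\<Sum>k\<le>N. d k * fps_nth (U * F) k) = (\<Sum>i\<le>N. e i * fps_nth F i)"
proof
  fix F :: "complex fps"
  have "(\<Sum>k\<le>N. d k * fps_nth (U * F) k) = (\<Sum>k\<le>N. \<Sum>i\<le>k. d k * (fps_nth U (k - i) * fps_nth F i))"
    by (subst mult.commute) (simp add: fps_mult_nth sum_distrib_left atLeast0AtMost mult_ac)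
  also have "\<dots> = (\<Sum>i\<le>N. \<Sum>k\<in>{i..N}. d k * (fps_nth U (k - i) * fps_nth F i))"
  proof -
    have "{..k} = {i \<in> {..N}. i \<le> k}" if "k \<in> {..N}" for k using that by auto
    moreover have "{i..N} = {k \<in> {..N}. i \<le> k}" for i by auto
    ultimately show ?thesis
      using sum.swap_restrict[of "{..N}" "{..N}" "\<lambda>k i. d k * (fps_nth U (k - i) * fps_nth F i)" "\<lambda>k i. i \<le> k"]
      by simp
  qed
  also have "\<dots> = (\<Sum>i\<le>N. (\<Sum>k\<in>{i..N}. d k * fps_nth U (k - i)) * fps_nth F i)"
    by (simp add: sum_distrib_right sum_distrib_left mult_ac)
  finally show "(\<Sum>k\<le>N. d k * fps_nth (U * F) k) = (\<Sum>i\<le>N. (\<Sum>k\<in>{i..N}. d k * fps_nth U (k - i)) * fps_nth F i)" .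
qed

text \<open>Feynman's parametrization makes the product an average, with probability density (q +
  1)(1 - s)^q, of kernels of the next order at points of the segment from \<open>w\<close> to
  \<open>y\<close>, which stays in the closed disk.\<close>

lemma kernel_product_functional_bound:
  assumes bd: "\<And>u. cmod u \<le> 1 \<Longrightarrow> Re (\<Sum>k\<le>N. d k * fps_nth (U * kernel_fps (q + 1) u) k) \<le> M"
    and "cmod y \<le> 1" "cmod w \<le> 1"
  shows "Re (\<Sum>k\<le>N. d k * fps_nth (U * (kernel_fps 0 y * kernel_fps q w)) k) \<le> M"
proof -
  obtain e where e: "\<And>F. (\<Sum>k\<le>N. d k * fps_nth (U * F) k) = (\<Sum>i\<le>N. e i * fps_nth F i)"
    using fps_functional_mult by blast
  define u where "u = (\<lambda>s::real. of_real s * y + of_real (1 - s) * w)"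
  define \<rho> where "\<rho> = (\<lambda>s::real. real (q + 1) * (1 - s) ^ q)"
  have I: "((\<lambda>s. of_real (\<rho> s) * fps_nth (kernel_fps (q + 1) (u s)) k) has_integral
      fps_nth (kernel_fps 0 y * kernel_fps q w) k) {0..1}" for k
    unfolding u_def \<rho>_def by (rule Feynman_parametrization)
  have "((\<lambda>s. \<Sum>k\<le>N. e k * (of_real (\<rho> s) * fps_nth (kernel_fps (q + 1) (u s)) k)) has_integral
      (\<Sum>k\<le>N. e k * fps_nth (kernel_fps 0 y * kernel_fps q w) k)) {0..1}"
    by (intro has_integral_sum has_integral_mult_right I) auto
  from has_integral_linear[OF this bounded_linear_Re]
  have "((\<lambda>s. Re (\<Sum>k\<le>N. e k * (of_real (\<rho> s) * fps_nth (kernel_fps (q + 1) (u s)) k))) has_integral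
      Re (\<Sum>k\<le>N. e k * fps_nth (kernel_fps 0 y * kernel_fps q w) k)) {0..1}"
    by (simp only: o_def)
  moreover have "((\<lambda>s. \<rho> s * M) has_integral 1 * M) {0..1}"
  proof -
    \<comment> \<open>Every kernel has constant coefficient 1, so the parametrization at index 0
      gives total mass 1.\<close>
    have "(\<lambda>s. of_real (\<rho> s) :: complex) = (\<lambda>s. of_real (\<rho> s) * fps_nth (kernel_fps (q + 1) (u s)) 0)"
      by (simp add: kernel_fps_def del: binomial_Suc_Suc)
    then have "((\<lambda>s. of_real (\<rho> s)) has_integral (1::complex)) {0..1}"
      using I[of 0] by (simp add: kernel_fps_def)
    from has_integral_linear[OF this bounded_linear_Re]
    have "(\<rho> has_integral 1) {0..1}" by (simp add: o_def)
    then show ?thesis by (rule has_integral_mult_left)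
  qed
  ultimately have "Re (\<Sum>k\<le>N. e k * fps_nth (kernel_fps 0 y * kernel_fps q w) k) \<le> 1 * M"
  proof (rule has_integral_le)
    fix s :: real assume s: "s \<in> {0..1}"
    have "cmod (u s) \<le> s * cmod y + (1 - s) * cmod w"
      unfolding u_def using s by (intro norm_triangle_le) (simp add: norm_mult flip: of_real_diff)
    also have "\<dots> \<le> 1" using s assms(2,3) by (intro convex_bound_le) auto
    finally have "Re (\<Sum>k\<le>N. e k * fps_nth (kernel_fps (q + 1) (u s)) k) \<le> M"
      unfolding e[symmetric] by (rule bd)
    moreover have "\<rho> s \<ge> 0" using s by (simp add: \<rho>_def)
    moreover have "(\<Sum>k\<le>N. e k * (of_real (\<rho> s) * fps_nth (kernel_fps (q + 1) (u s)) k))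
        = of_real (\<rho> s) * (\<Sum>k\<le>N. e k * fps_nth (kernel_fps (q + 1) (u s)) k)"
      by (simp add: sum_distrib_left mult_ac)
    ultimately show "Re (\<Sum>k\<le>N. e k * (of_real (\<rho> s) * fps_nth (kernel_fps (q + 1) (u s)) k)) \<le> \<rho> s * M"
      by (simp add: mult_left_mono)
  qed
  then show ?thesis unfolding e by simp
qed

text \<open>The functional is a polynomial in \<open>u\<close>, so its real part obeys the maximum
  principle. This brings the interior points produced by Feynman averaging back to the
  circle.\<close>

lemma kernel_functional_bound_disk:
  assumes bd: "\<And>u. cmod u = 1 \<Longrightarrow> Re (\<Sum>k\<le>N. d k * fps_nth (U * kernel_fps q u) k) \<le> M"
    and "cmod u \<le> 1"
  shows "Re (\<Sum>k\<le>N. d k * fps_nth (U * kernel_fps q u) k) \<le> M"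
proof (rule maximum_real_frontier[of "\<lambda>u. \<Sum>k\<le>N. d k * fps_nth (U * kernel_fps q u) k" "cball 0 1"])
  have hol: "(\<lambda>u. \<Sum>k\<le>N. d k * fps_nth (U * kernel_fps q u) k) holomorphic_on A" for A
    unfolding kernel_fps_def fps_mult_nth fps_nth_Abs_fps by (intro holomorphic_intros)
  show "(\<lambda>u. \<Sum>k\<le>N. d k * fps_nth (U * kernel_fps q u) k) holomorphic_on interior (cball 0 1)"
    by (rule hol)
  show "continuous_on (closure (cball 0 1)) (\<lambda>u. \<Sum>k\<le>N. d k * fps_nth (U * kernel_fps q u) k)"
    by (rule holomorphic_on_imp_continuous_on[OF hol])
qed (use assms in auto)

text \<open>\<open>U\<close> is absorbed into the functional, and \<open>F\<close> is then an
  average of simple kernels.\<close>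

lemma half_plane_functional_bound_mult:
  assumes P: "P holomorphic_on ball 0 1" "P has_fps_expansion F" "P 0 = 1" "\<And>z. z \<in> ball 0 1 \<Longrightarrow> 1 / 2 < Re (P z)"
    and bd: "\<And>y. cmod y = 1 \<Longrightarrow> Re (\<Sum>k\<le>N. d k * fps_nth (U * kernel_fps 0 y) k) \<le> M"
  shows "Re (\<Sum>k\<le>N. d k * fps_nth (U * F) k) \<le> M"
proof -
  obtain e where e: "\<And>F. (\<Sum>k\<le>N. d k * fps_nth (U * F) k) = (\<Sum>i\<le>N. e i * fps_nth F i)"
    using fps_functional_mult by blast
  show ?thesis
    unfolding e by (rule half_plane_functional_bound[OF P]) (use bd in \<open>auto simp: e kernel_fps_def\<close>)
qed

lemma kernel_fps_0_mult: "kernel_fps 0 y * (1 - fps_const y * fps_X) = 1"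
  by (rule fps_ext) (auto simp: right_diff_distrib kernel_fps_def mult.assoc[symmetric] fps_mult_right_const_nth
      fps_X_mult_right_nth power_eq_if)

text \<open>
  The dual form of the Brannan--Clunie--Kirwan theorem: the derivatives of close-to-convex functions lie in
  the closed convex hull of the functions \<open>(1 + xz) / (1 - uz)\<^sup>3\<close> with \<open>|x| = |u| = 1\<close>.
\<close>

lemma close_to_convex_functional_bound:
  assumes f: "f \<in> close_to_convex" "f has_fps_expansion F"
    and bd: "\<And>x u. cmod x = 1 \<Longrightarrow> cmod u = 1 \<Longrightarrow>
      Re (\<Sum>k\<le>N. d k * fps_nth ((1 + fps_const x * fps_X) * kernel_fps 2 u) k) \<le> M"
  shows "Re (\<Sum>k\<le>N. d k * fps_nth (fps_deriv F) k) \<le> M"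
proof -
  define T where "T = (\<lambda>F. Re (\<Sum>k\<le>N. d k * fps_nth F k))"
  obtain P Q c where P: "P holomorphic_on unit_disk" "P 0 = 1" "\<And>z. z \<in> unit_disk \<Longrightarrow> 1 / 2 < Re (P z)"
    and Q: "Q holomorphic_on unit_disk" "Q 0 = 1" "\<And>z. z \<in> unit_disk \<Longrightarrow> 1 / 2 < Re (Q z)"
    and c: "cmod c = 1"
    and fPQ: "\<And>z. z \<in> unit_disk \<Longrightarrow> deriv f z = (P z)\<^sup>2 * (- c + (1 + c) * Q z)"
    using close_to_convex_factorization[OF f(1)] by metis
  define p q where "p = fps_expansion P 0" and "q = fps_expansion Q 0"
  have p: "P has_fps_expansion p" and q: "Q has_fps_expansion q"
    unfolding p_def q_def by (rule has_fps_expansion_fps_expansion[OF open_ball _ P(1)], simp,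
      rule has_fps_expansion_fps_expansion[OF open_ball _ Q(1)], simp)
  have expr: "(\<lambda>z. (P z)\<^sup>2 * (- c + (1 + c) * Q z)) has_fps_expansion p\<^sup>2 * (fps_const (- c) + fps_const (1 + c) * q)"
    by (intro fps_expansion_intros p q)
  have ev: "\<forall>\<^sub>F z in nhds 0. (P z)\<^sup>2 * (- c + (1 + c) * Q z) = deriv f z"
    by (rule eventually_mono[OF eventually_nhds_in_open[of unit_disk 0]]) (auto simp: fPQ)
  have "deriv f has_fps_expansion p\<^sup>2 * (fps_const (- c) + fps_const (1 + c) * q)"
    using expr has_fps_expansion_cong[OF ev refl] by blast
  then have F: "fps_deriv F = p\<^sup>2 * (fps_const (- c) + fps_const (1 + c) * q)"
    using has_fps_expansion_deriv[OF f(2)] fps_expansion_unique_complex by blast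
  \<comment> \<open>Three simple kernels are merged in two rounds: here a simple and a squared
    kernel become a cubic one, and in fact \<open>2\<close> a pair of simple kernels becomes a
    squared one.\<close>
  have 1: "T ((1 + fps_const x * fps_X) * (kernel_fps 0 y * kernel_fps 1 w)) \<le> M"
    if "cmod x = 1" "cmod y \<le> 1" "cmod w \<le> 1" for x y w
    unfolding T_def
  proof (rule kernel_product_functional_bound)
    fix u :: complex assume "cmod u \<le> 1"
    then show "Re (\<Sum>k\<le>N. d k * fps_nth ((1 + fps_const x * fps_X) * kernel_fps (1 + 1) u) k) \<le> M"
      unfolding one_add_one by (rule kernel_functional_bound_disk[rotated]) (rule bd[OF \<open>cmod x = 1\<close>])
  qed (use that in auto)
  have 2: "T (((1 + fps_const x * fps_X) * kernel_fps 0 y) * (kernel_fps 0 v * kernel_fps 0 w)) \<le> M"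
    if "cmod x = 1" "cmod y \<le> 1" "cmod v \<le> 1" "cmod w \<le> 1" for x y v w
    unfolding T_def
    by (rule kernel_product_functional_bound)
      (use that 1 in \<open>auto simp: T_def simp del: One_nat_def simp flip: mult.assoc\<close>)
  \<comment> \<open>With Q replaced by a kernel the affine factor becomes (1 + c y z)/(1 - y z), and
    |c y| = 1, so \<open>2\<close> applies with x = c y.\<close>
  have 3: "T ((fps_const (- c) + fps_const (1 + c) * kernel_fps 0 y) * (kernel_fps 0 v * kernel_fps 0 w)) \<le> M"
    if "cmod y = 1" "cmod v = 1" "cmod w = 1" for y v w
  proof -
    have "fps_const (- c) + fps_const (1 + c) * kernel_fps 0 y
       = fps_const (- c) * (kernel_fps 0 y * (1 - fps_const y * fps_X)) + fps_const (1 + c) * kernel_fps 0 y"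
      by (simp add: kernel_fps_0_mult)
    also have "\<dots> = (1 + fps_const (c * y) * fps_X) * kernel_fps 0 y"
      by (simp add: algebra_simps flip: fps_const_add fps_const_neg fps_const_mult)
    finally show ?thesis using 2[of "c * y" y v w] that c by (simp add: norm_mult)
  qed
  \<comment> \<open>From here the kernels are exchanged back for the actual functions, first the two
    copies of \<open>p\<close>, then \<open>q\<close>.\<close>
  have 4: "T ((fps_const (- c) + fps_const (1 + c) * kernel_fps 0 y) * kernel_fps 0 v * p) \<le> M"
    if "cmod y = 1" "cmod v = 1" for y v
    unfolding T_def by (rule half_plane_functional_bound_mult[OF P(1) p P(2,3)]) 
      (use 3 that in \<open>auto simp: T_def mult.assoc\<close>)
  have 5: "T ((fps_const (- c) + fps_const (1 + c) * kernel_fps 0 y) * p * p) \<le> M"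
    if "cmod y = 1" for y
    unfolding T_def by (rule half_plane_functional_bound_mult[OF P(1) p P(2,3)]) 
      (use 4 that in \<open>auto simp: T_def mult_ac\<close>)
  have T_add: "T (G + H) = T G + T H" for G H
    by (simp add: T_def distrib_left sum.distrib del: times_complex.sel Re_sum)
  have eq: "(fps_const (- c) + fps_const (1 + c) * h) * p * p = p\<^sup>2 * fps_const (- c) + (p\<^sup>2 * fps_const (1 + c)) * h" for h
    by (simp add: power2_eq_square algebra_simps)
  \<comment> \<open>The term without \<open>q\<close> is moved into the bound, so that what remains
    is a multiple of \<open>q\<close>.\<close>
  have "T ((p\<^sup>2 * fps_const (1 + c)) * q) \<le> M - T (p\<^sup>2 * fps_const (- c))"
    unfolding T_def
  proof (rule half_plane_functional_bound_mult[OF Q(1) q Q(2,3)])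
    fix y :: complex assume "cmod y = 1"
    from 5[OF this] have "T ((p\<^sup>2 * fps_const (1 + c)) * kernel_fps 0 y) \<le> M - T (p\<^sup>2 * fps_const (- c))"
      unfolding eq T_add by simp
    then show "Re (\<Sum>k\<le>N. d k * fps_nth (p\<^sup>2 * fps_const (1 + c) * kernel_fps 0 y) k)
        \<le> M - Re (\<Sum>k\<le>N. d k * fps_nth (p\<^sup>2 * fps_const (- c)) k)"
      by (simp only: T_def)
  qed
  then have "T ((fps_const (- c) + fps_const (1 + c) * q) * p * p) \<le> M"
    unfolding eq T_add by simp
  moreover have "(fps_const (- c) + fps_const (1 + c) * q) * p * p = fps_deriv F"
    unfolding F power2_eq_square by (simp only: mult_ac)
  ultimately show ?thesis by (simp add: T_def)
qed

section \<open>The extremal problem\<close>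

lemma binary_quadratic_form_nonneg:
  fixes p q r u v :: real
  assumes "p \<ge> 0" "r \<ge> 0" "q\<^sup>2 \<le> p * r"
  shows "0 \<le> p * u\<^sup>2 + 2 * q * u * v + r * v\<^sup>2"
proof (cases "p = 0")
  case True
  then have "q = 0" using assms(3) by simp
  then show ?thesis using True assms(2) by simp
next
  case False
  have "p * (p * u\<^sup>2 + 2 * q * u * v + r * v\<^sup>2) = (p * u + q * v)\<^sup>2 + (p * r - q\<^sup>2) * v\<^sup>2"
    by (simp add: power2_eq_square algebra_simps)
  also have "\<dots> \<ge> 0" using assms(3) by simp
  finally show ?thesis
    using False assms(1) by (simp add: zero_le_mult_iff)
qed

text \<open>
  Lagrangian bound: \<open>m1\<close> and \<open>m2\<close> are multipliers for the constraints \<open>|W| = 1\<close> and \<open>|Y| = 1\<close>.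
  The Lagrangian splits into a form in the imaginary parts and a form in the real parts.
\<close>

lemma extremal_bound:
  fixes N lam m1 m2 p q r :: real and W Y :: complex
  assumes "m1 \<ge> 0" "m2 \<ge> 0" and im: "(N - 1)\<^sup>2 \<le> 4 * m1 * m2"
    and p: "p = m1 + 2 * N - lam * (N + 1)\<^sup>2 / 4" "p \<ge> 0"
    and r: "r = m2 - lam * (N - 1)\<^sup>2 / 4" "r \<ge> 0"
    and q: "q = (N - 1) * (2 - lam * (N + 1)) / 4" "q\<^sup>2 \<le> p * r"
    and "cmod W = 1" "cmod Y = 1"
  shows "lam * ((N + 1) / 2 * Re W + (N - 1) / 2 * Re Y)\<^sup>2
           - (N * Re (W\<^sup>2) + (N - 1) * Re (W * Y)) \<le> N + m1 + m2"
proof -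
  have W: "(Re W)\<^sup>2 + (Im W)\<^sup>2 = 1" and Y: "(Re Y)\<^sup>2 + (Im Y)\<^sup>2 = 1"
    using assms by (simp_all add: cmod_def)
  have "0 \<le> p * (Re W)\<^sup>2 + 2 * q * Re W * Re Y + r * (Re Y)\<^sup>2"
    using p(2) r(2) q(2) by (rule binary_quadratic_form_nonneg)
  moreover have "0 \<le> m1 * (Im W)\<^sup>2 + 2 * (- (N - 1) / 2) * Im W * Im Y + m2 * (Im Y)\<^sup>2"
    using assms(1,2) im
    by (intro binary_quadratic_form_nonneg) (auto simp: power2_eq_square algebra_simps)
  ultimately have "0 \<le> p * (Re W)\<^sup>2 + 2 * q * Re W * Re Y + r * (Re Y)\<^sup>2
      + (m1 * (Im W)\<^sup>2 + 2 * (- (N - 1) / 2) * Im W * Im Y + m2 * (Im Y)\<^sup>2)"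
    by simp
  also have "\<dots> = (N + m1) * ((Re W)\<^sup>2 + (Im W)\<^sup>2) + m2 * ((Re Y)\<^sup>2 + (Im Y)\<^sup>2)
      - lam * ((N + 1) / 2 * Re W + (N - 1) / 2 * Re Y)\<^sup>2
      + (N * ((Re W)\<^sup>2 - (Im W)\<^sup>2) + (N - 1) * (Re W * Re Y - Im W * Im Y))"
    unfolding p(1) q(1) r(1) by (simp add: power2_eq_square field_simps)
  finally show ?thesis
    unfolding W Y by (simp add: power2_eq_square)
qed

text \<open>The multipliers are chosen so that the form in the real parts is a multiple of (Re W -
  Re Y)^2 and the bound is the value at W = Y = 1, the Koebe case. The discriminant condition for
  the imaginary parts becomes \<lambda>^2 N (N + 1) - 6 \<lambda> N + 4 \<ge> 0, whose larger root
  is the threshold.\<close>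

lemma extremal_bound_large_lambda:
  fixes N lam :: real and W Y :: complex
  assumes N: "N \<ge> 3" and lam: "lam \<ge> (3 * N + sqrt (5 * N\<^sup>2 - 4 * N)) / (N\<^sup>2 + N)"
    and "cmod W = 1" "cmod Y = 1"
  shows "lam * ((N + 1) / 2 * Re W + (N - 1) / 2 * Re Y)\<^sup>2
           - (N * Re (W\<^sup>2) + (N - 1) * Re (W * Y)) \<le> lam * N\<^sup>2 - (2 * N - 1)"
proof -
  define R where "R = sqrt (5 * N\<^sup>2 - 4 * N)"
  have NN: "3 * N \<le> N\<^sup>2"
    using N by (simp add: power2_eq_square)
  have "2 * N - 1 \<le> R"
    unfolding R_def using NN N by (intro real_le_rsqrt) (simp add: power2_diff power_mult_distrib)
  have R2: "R\<^sup>2 = 5 * N\<^sup>2 - 4 * N"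
    unfolding R_def using NN N by (intro real_sqrt_pow2) simp
  have L: "3 * N + R \<le> lam * (N\<^sup>2 + N)"
    using lam N by (simp add: R_def pos_divide_le_eq add_pos_pos)
  have "0 \<le> R" using \<open>2 * N - 1 \<le> R\<close> N by simp
  then have "R\<^sup>2 \<le> (lam * (N\<^sup>2 + N) - 3 * N)\<^sup>2"
    using L by (intro power_mono) auto
  then have "0 \<le> N * (N + 1) * (lam\<^sup>2 * N * (N + 1) - 6 * lam * N + 4)"
    unfolding R2 by (simp add: power2_eq_square algebra_simps)
  then have quad: "0 \<le> lam\<^sup>2 * N * (N + 1) - 6 * lam * N + 4"
    using N by (subst (asm) zero_le_mult_iff) (auto simp: mult_le_0_iff)
  have m1: "5 * N - 1 \<le> lam * (N\<^sup>2 + N)"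
    using L \<open>2 * N - 1 \<le> R\<close> by simp
  have "2 * N \<le> lam * (N + 1) * N"
    using m1 N by (simp add: power2_eq_square algebra_simps)
  then have k: "2 \<le> lam * (N + 1)"
    using N by simp
  then have "0 < lam * (N + 1)" by linarith
  then have "lam > 0" using N by (simp add: zero_less_mult_iff)
  have "lam * (N + 1) \<le> lam * (2 * N)"
    using \<open>lam > 0\<close> N by simp
  then have m2: "1 \<le> lam * N" using k by simp
  have N1: "N - 1 \<ge> 0" using N by simp
  have pr: "(N - 1) * (lam * (N + 1) - 2) / 4 \<ge> 0"
    using N1 k by simp
  have "lam * ((N + 1) / 2 * Re W + (N - 1) / 2 * Re Y)\<^sup>2 - (N * Re (W\<^sup>2) + (N - 1) * Re (W * Y))
      \<le> N + (lam * (N\<^sup>2 + N) - (5 * N - 1)) / 2 + (N - 1) * (lam * N - 1) / 2"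
  proof (rule extremal_bound[where p = "(N - 1) * (lam * (N + 1) - 2) / 4"
        and r = "(N - 1) * (lam * (N + 1) - 2) / 4" and q = "(N - 1) * (2 - lam * (N + 1)) / 4"])
    have "0 \<le> N * (N - 1) * (lam\<^sup>2 * N * (N + 1) - 6 * lam * N + 4)"
      using N quad by simp
    then have "(N - 1)\<^sup>2 \<le> (lam * (N\<^sup>2 + N) - (5 * N - 1)) * ((N - 1) * (lam * N - 1))"
      by (simp add: power2_eq_square algebra_simps)
    then show "(N - 1)\<^sup>2 \<le> 4 * ((lam * (N\<^sup>2 + N) - (5 * N - 1)) / 2) * ((N - 1) * (lam * N - 1) / 2)"
      by (simp add: field_simps)
    show "0 \<le> (N - 1) * (lam * N - 1) / 2"
      using N1 m2 by simp
  qed (use assms m1 pr in \<open>simp_all add: power2_eq_square field_simps\<close>)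
  also have "\<dots> = lam * N\<^sup>2 - (2 * N - 1)"
    by (simp add: power2_eq_square field_simps)
  finally show ?thesis .
qed

text \<open>Both multipliers equal (N - 1)/2, so the form in the imaginary parts is a multiple of
  (Im W - Im Y)^2 and the bound is the value at W = Y = \<i>. The discriminant condition for the
  real parts is exactly the threshold on \<open>lam\<close>.\<close>

lemma extremal_bound_small_lambda:
  fixes N lam :: real and W Y :: complex
  assumes N: "N \<ge> 3" and lam: "0 < lam" "lam \<le> 2 * N / (N\<^sup>2 - N + 1)"
    and "cmod W = 1" "cmod Y = 1"
  shows "lam * ((N + 1) / 2 * Re W + (N - 1) / 2 * Re Y)\<^sup>2
           - (N * Re (W\<^sup>2) + (N - 1) * Re (W * Y)) \<le> 2 * N - 1"
proof -
  define K where "K = N\<^sup>2 - N + 1"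
  have "3 * N \<le> N\<^sup>2"
    using N by (simp add: power2_eq_square)
  then have pos: "K > 0" "N - 1 > 0"
    using N by (simp_all add: K_def)
  have L: "lam * K \<le> 2 * N"
    using lam pos by (simp add: pos_le_divide_eq K_def)
  have "(lam * (N - 1)) * K = (lam * K) * (N - 1)" by simp
  also have "\<dots> \<le> 2 * N * (N - 1)"
    using L pos by (intro mult_right_mono) auto
  also have "\<dots> \<le> 2 * K" by (simp add: K_def power2_eq_square algebra_simps)
  finally have "lam * (N - 1) \<le> 2" using pos by simp
  then have "(lam * (N - 1)) * (N - 1) \<le> 2 * (N - 1)"
    using pos by (intro mult_right_mono) auto
  then have r: "lam * (N - 1)\<^sup>2 \<le> 2 * (N - 1)"
    by (simp add: power2_eq_square algebra_simps)
  have "(lam * (N + 1)\<^sup>2) * K = (lam * K) * (N + 1)\<^sup>2" by simp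
  also have "\<dots> \<le> 2 * N * (N + 1)\<^sup>2"
    using L by (intro mult_right_mono) auto
  \<comment> \<open>The added term is the exact difference to
    \<open>2 * (5 * N - 1) * K\<close>.\<close>
  also have "\<dots> \<le> 2 * N * (N + 1)\<^sup>2 + 2 * ((N - 1) * (2 * N - 1)\<^sup>2)"
    using pos by simp
  also have "\<dots> = 2 * (5 * N - 1) * K"
    by (simp add: K_def power2_eq_square algebra_simps)
  finally have p: "lam * (N + 1)\<^sup>2 \<le> 2 * (5 * N - 1)" using pos by simp
  have "lam * ((N + 1) / 2 * Re W + (N - 1) / 2 * Re Y)\<^sup>2 - (N * Re (W\<^sup>2) + (N - 1) * Re (W * Y))
      \<le> N + (N - 1) / 2 + (N - 1) / 2"
  proof (rule extremal_bound[OF _ _ _ refl _ refl _ refl])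
    have "0 \<le> (N - 1) * (2 * N - lam * K)"
      using pos L by simp
    then show "((N - 1) * (2 - lam * (N + 1)) / 4)\<^sup>2 \<le>
       ((N - 1) / 2 + 2 * N - lam * (N + 1)\<^sup>2 / 4) * ((N - 1) / 2 - lam * (N - 1)\<^sup>2 / 4)"
      by (simp add: K_def power2_eq_square field_simps)
    show "(N - 1)\<^sup>2 \<le> 4 * ((N - 1) / 2) * ((N - 1) / 2)"
      by (simp add: power2_eq_square field_simps)
  qed (use assms pos r p in \<open>simp_all add: power2_eq_square diff_divide_distrib\<close>)
  then show ?thesis by (simp add: field_simps)
qed

text \<open>Here the multipliers make both forms degenerate: 4 m1 m2 = (N - 1)^2 and p r = q^2. The
  square root in the bound enters through them.\<close>

lemma extremal_bound_middle_lambda: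
  fixes N lam :: real and W Y :: complex
  assumes N: "N \<ge> 3" and lam: "0 < lam" "lam < (3 * N + sqrt (5 * N\<^sup>2 - 4 * N)) / (N\<^sup>2 + N)"
    and "cmod W = 1" "cmod Y = 1"
  shows "lam * ((N + 1) / 2 * Re W + (N - 1) / 2 * Re Y)\<^sup>2
           - (N * Re (W\<^sup>2) + (N - 1) * Re (W * Y))
         \<le> (lam * (4 * N * (N + 1) - (3 * N\<^sup>2 + 1) * lam) + 4 * N * (2 - lam) * sqrt (N * lam * (2 - lam)))
            / (lam * (8 * N - lam * (N + 1)\<^sup>2))"
proof -
  define D where "D = lam * (8 * N - lam * (N + 1)\<^sup>2)"
  define w where "w = sqrt (N * lam * (2 - lam))"
  have "3 * N \<le> N\<^sup>2"
    using N by (simp add: power2_eq_square)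
  \<comment> \<open>This shows that the upper threshold lies below 8 N/(N + 1)^2, so the denominator
    \<open>D\<close> is positive.\<close>
  have "0 < 4 * N * (N - 1)\<^sup>2 * (5 * N + 1)"
    using N by simp
  also have "\<dots> = (5 * N\<^sup>2 - 3 * N)\<^sup>2 - (5 * N\<^sup>2 - 4 * N) * (N + 1)\<^sup>2"
    by (simp add: power2_eq_square algebra_simps)
  finally have "sqrt ((5 * N\<^sup>2 - 4 * N) * (N + 1)\<^sup>2) < 5 * N\<^sup>2 - 3 * N"
    using N \<open>3 * N \<le> N\<^sup>2\<close> by (intro real_less_lsqrt) auto
  then have "sqrt (5 * N\<^sup>2 - 4 * N) * (N + 1) < 5 * N\<^sup>2 - 3 * N"
    using N by (simp add: real_sqrt_mult)
  then have "(3 * N + sqrt (5 * N\<^sup>2 - 4 * N)) * (N + 1) < 8 * N\<^sup>2"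
    by (simp add: power2_eq_square algebra_simps)
  moreover have "lam * (N\<^sup>2 + N) < 3 * N + sqrt (5 * N\<^sup>2 - 4 * N)"
    using lam N by (simp add: pos_less_divide_eq add_pos_pos)
  then have "lam * (N\<^sup>2 + N) * (N + 1) < (3 * N + sqrt (5 * N\<^sup>2 - 4 * N)) * (N + 1)"
    using N by (intro mult_strict_right_mono) auto
  ultimately have "N * (lam * (N + 1)\<^sup>2) < N * (8 * N)"
    by (simp add: power2_eq_square algebra_simps)
  then have L: "lam * (N + 1)\<^sup>2 < 8 * N" using N by simp
  then have "D > 0" using lam by (simp add: D_def)
  have "8 * N \<le> 2 * (N + 1)\<^sup>2"
    using zero_le_power2[of "N - 1"] by (simp add: power2_eq_square algebra_simps)
  then have "lam * (N + 1)\<^sup>2 < 2 * (N + 1)\<^sup>2" using L by simp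
  then have "lam < 2" using N by (simp add: mult_less_cancel_right)
  have w2: "w\<^sup>2 = N * lam * (2 - lam)" and "w \<ge> 0"
    using lam N \<open>lam < 2\<close> by (simp_all add: w_def)
  \<comment> \<open>This identity drives the computation: \<open>D\<close> factors as the product of
    2 w - \<lambda> (N - 1) and 2 w + \<lambda> (N - 1), the numerators of the two
    multipliers.\<close>
  have wD: "4 * w\<^sup>2 = D + (lam * (N - 1))\<^sup>2"
    unfolding w2 D_def by (simp add: power2_eq_square algebra_simps)
  have "(lam * (N - 1))\<^sup>2 \<le> (2 * w)\<^sup>2"
    using wD \<open>D > 0\<close> by (simp add: power_mult_distrib)
  then have m1: "lam * (N - 1) \<le> 2 * w"
    by (rule power2_le_imp_le) (use \<open>w \<ge> 0\<close> in simp)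
  have "lam \<noteq> 0" "D \<noteq> 0" using lam \<open>D > 0\<close> by auto
  define m1 where "m1 = (2 * w - lam * (N - 1)) / (2 * lam)"
  define m2 where "m2 = lam * (N - 1)\<^sup>2 * (2 * w + lam * (N - 1)) / (2 * D)"
  define p where "p = (4 * w + (D - 2 * lam * (N - 1))) / (4 * lam)"
  define r where "r = lam * (N - 1)\<^sup>2 * (4 * w - (D - 2 * lam * (N - 1))) / (4 * D)"
  define q where "q = (N - 1) * (2 - lam * (N + 1)) / 4"
  have p: "p = m1 + 2 * N - lam * (N + 1)\<^sup>2 / 4"
  proof -
    have "D / (4 * lam) = 2 * N - lam * (N + 1)\<^sup>2 / 4"
      using \<open>lam \<noteq> 0\<close> by (simp add: D_def diff_divide_distrib)
    moreover have "p = m1 + D / (4 * lam)"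
      using \<open>lam \<noteq> 0\<close> by (simp add: p_def m1_def add_divide_distrib diff_divide_distrib)
    ultimately show ?thesis by simp
  qed
  have r: "r = m2 - lam * (N - 1)\<^sup>2 / 4"
    using \<open>D \<noteq> 0\<close> by (simp add: r_def m2_def divide_simps) (simp add: algebra_simps)
  have "m1 \<ge> 0" using m1 lam by (simp add: m1_def)
  have "m2 \<ge> 0" using \<open>w \<ge> 0\<close> lam N \<open>D > 0\<close> by (simp add: m2_def)
  have "p > 0" unfolding p using \<open>m1 \<ge> 0\<close> L by simp
  have "4 * (x / (2 * lam)) * (lam * c * y / (2 * D)) = c * (x * y) / D" for x y c :: real
    using \<open>lam \<noteq> 0\<close> \<open>D \<noteq> 0\<close> by simp
  then have "4 * m1 * m2 = (N - 1)\<^sup>2 * ((2 * w - lam * (N - 1)) * (2 * w + lam * (N - 1))) / D"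
    unfolding m1_def m2_def .
  also have "(2 * w - lam * (N - 1)) * (2 * w + lam * (N - 1)) = 4 * w\<^sup>2 - (lam * (N - 1))\<^sup>2"
    by (simp add: power2_eq_square algebra_simps)
  finally have m12: "4 * m1 * m2 = (N - 1)\<^sup>2"
    using wD \<open>D \<noteq> 0\<close> by simp
  have "x / (4 * lam) * (lam * c * y / (4 * D)) = c * (x * y) / (16 * D)" for x y c :: real
    using \<open>lam \<noteq> 0\<close> \<open>D \<noteq> 0\<close> by simp
  then have "p * r = (N - 1)\<^sup>2 * ((4 * w + (D - 2 * lam * (N - 1))) * (4 * w - (D - 2 * lam * (N - 1)))) / (16 * D)"
    unfolding p_def r_def .
  also have "(4 * w + (D - 2 * lam * (N - 1))) * (4 * w - (D - 2 * lam * (N - 1)))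
      = 4 * (4 * w\<^sup>2) - (D - 2 * lam * (N - 1))\<^sup>2"
    by (simp add: power2_eq_square algebra_simps)
  also have "4 * (4 * w\<^sup>2) - (D - 2 * lam * (N - 1))\<^sup>2 = D * (4 - D + 4 * lam * (N - 1))"
    unfolding wD by (simp add: power2_eq_square algebra_simps)
  also have "4 - D + 4 * lam * (N - 1) = (2 - lam * (N + 1))\<^sup>2"
    unfolding D_def by (simp add: power2_eq_square algebra_simps)
  finally have pr: "p * r = q\<^sup>2"
    using \<open>D \<noteq> 0\<close> by (simp add: q_def power_mult_distrib power_divide)
  then have "r \<ge> 0" using \<open>p > 0\<close> by (metis zero_le_mult_iff zero_le_power2 not_less)
  have "lam * ((N + 1) / 2 * Re W + (N - 1) / 2 * Re Y)\<^sup>2 - (N * Re (W\<^sup>2) + (N - 1) * Re (W * Y))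
      \<le> N + m1 + m2"
    using \<open>m1 \<ge> 0\<close> \<open>m2 \<ge> 0\<close> _ p _ r \<open>r \<ge> 0\<close> q_def _ assms(4,5)
    by (rule extremal_bound) (use m12 pr \<open>p > 0\<close> in auto)
  also have "\<dots> = (lam * (4 * N * (N + 1) - (3 * N\<^sup>2 + 1) * lam) + 4 * N * (2 - lam) * w) / D"
  proof -
    have "lam * ((N + m1 + m2) * D) = lam * (lam * (4 * N * (N + 1) - (3 * N\<^sup>2 + 1) * lam) + 4 * N * (2 - lam) * w)"
    proof -
      have "m1 * lam = w - lam * (N - 1) / 2" "m2 * D = lam * (N - 1)\<^sup>2 * (2 * w + lam * (N - 1)) / 2"
        using lam \<open>D > 0\<close> by (simp_all add: m1_def m2_def field_simps)
      then have "lam * ((N + m1 + m2) * D) =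
         N * lam * D + (w - lam * (N - 1) / 2) * D + lam * (lam * (N - 1)\<^sup>2 * (2 * w + lam * (N - 1)) / 2)"
        by (metis (no_types, opaque_lifting) distrib_left mult.assoc mult.commute)
      then show ?thesis
        by (simp add: D_def power2_eq_square field_simps)
    qed
    then show ?thesis using lam \<open>D > 0\<close> by (simp add: eq_divide_eq)
  qed
  finally show ?thesis unfolding D_def w_def .
qed

section \<open>The generalized Zalcman functional\<close>

lemma Re_of_real_mult: "Re (of_real r * z) = r * Re z"
  by simp

lemma Re_power2_le: "Re (z\<^sup>2) \<le> (Re z)\<^sup>2"
  by (simp add: power2_eq_square)

text \<open>\<open>\<kappa>\<close> is a square root of the conjugate of \<open>sgn z\<close>. A
  square is wanted because the functional then splits into (\<kappa> a_n)^2 and \<kappa>^2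
  a_{2n-1}.\<close>

lemma exists_square_rotation:
  obtains \<kappa> where "cmod \<kappa> = 1" "of_real (cmod z) = \<kappa>\<^sup>2 * z"
proof (cases "z = 0")
  case False
  define \<kappa> where "\<kappa> = csqrt (cnj (sgn z))"
  have \<kappa>2: "\<kappa>\<^sup>2 = cnj (sgn z)" by (simp add: \<kappa>_def)
  have "(cmod \<kappa>)\<^sup>2 = 1"
    using False unfolding norm_power[symmetric] \<kappa>2 by (simp add: norm_sgn)
  then have "cmod \<kappa> = 1" by (simp add: power2_eq_1_iff) (use norm_ge_zero[of \<kappa>] in linarith)
  moreover have "of_real (cmod z) = \<kappa>\<^sup>2 * z"
    unfolding \<kappa>2 using False complex_norm_square[of z]
    by (simp add: sgn_eq field_simps power2_eq_square)
  ultimately show ?thesis by (rule that)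
qed (use that[of 1] in auto)

text \<open>After rotation the modulus is at most \<lambda> s^2 - Re(\<kappa>^2 a_{2n-1}) with s =
  Re(\<kappa> a_n). Replacing the square by its tangent at \<open>s\<close> gives a linear
  functional, which need only be bounded on the kernels (1 + xz)/(1 - uz)^3.\<close>

lemma generalized_Zalcman_bound:
  fixes n :: nat and lam M :: real
  assumes n: "n \<ge> 2" and "lam \<ge> 0" and f: "f \<in> close_to_convex" "has_normalized_expansion f a"
    and extremal: "\<And>W Y. cmod W = 1 \<Longrightarrow> cmod Y = 1 \<Longrightarrow>
      lam * ((real n + 1) / 2 * Re W + (real n - 1) / 2 * Re Y)\<^sup>2
        - (real n * Re (W\<^sup>2) + (real n - 1) * Re (W * Y)) \<le> M"
  shows "cmod (of_real lam * (a n)\<^sup>2 - a (2 * n - 1)) \<le> M"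
proof -
  define z where "z = of_real lam * (a n)\<^sup>2 - a (2 * n - 1)"
  obtain \<kappa> where \<kappa>: "cmod \<kappa> = 1" "of_real (cmod z) = \<kappa>\<^sup>2 * z"
    using exists_square_rotation by blast
  define s where "s = Re (\<kappa> * a n)"
  \<comment> \<open>The functional acts on the derivative, whose coefficients at n - 1 and 2n - 2
    are n a_n and (2n - 1) a_{2n-1}; hence the shifted indices and the divisions.\<close>
  define d where "d = (\<lambda>k. if k = n - 1 then 2 * of_real (lam * s) * \<kappa> / of_nat n
    else if k = 2 * n - 2 then - (\<kappa>\<^sup>2 / of_nat (2 * n - 1)) else 0)"
  have neq: "2 * n - 2 \<noteq> n - 1" using n by simp
  have d: "(\<Sum>k\<le>2 * n - 2. d k * fps_nth G k) = 2 * of_real (lam * s) * \<kappa> / of_nat n * fps_nth G (n - 1)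
      - \<kappa>\<^sup>2 / of_nat (2 * n - 1) * fps_nth G (2 * n - 2)" for G
  proof -
    have "(\<Sum>k\<le>2 * n - 2. d k * fps_nth G k) = (\<Sum>k\<in>{n - 1, 2 * n - 2}. d k * fps_nth G k)"
      using n by (intro sum.mono_neutral_right) (auto simp: d_def)
    then show ?thesis using neq by (simp add: d_def)
  qed
  define F where "F = Abs_fps (\<lambda>k. if k = 0 then 0 else if k = 1 then 1 else a k)"
  have "Re (\<Sum>k\<le>2 * n - 2. d k * fps_nth (fps_deriv F) k) \<le> lam * s\<^sup>2 + M"
  proof (rule close_to_convex_functional_bound[OF f(1)])
    show "f has_fps_expansion F"
      unfolding F_def by (rule has_normalized_expansion_imp_has_fps_expansion[OF f(2)])
    fix x u :: complex assume xu: "cmod x = 1" "cmod u = 1"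
    define G where "G = (1 + fps_const x * fps_X) * kernel_fps 2 u"
    \<comment> \<open>In these two points of the circle the rotated coefficients are (n+1)/2 W +
      (n-1)/2 Y and n W^2 + (n-1) W Y.\<close>
    define W Y where "W = \<kappa> * u ^ (n - 1)" and "Y = \<kappa> * x * u ^ (n - 2)"
    obtain m where m: "n = m + 2" using n by (metis le_add_diff_inverse2)
    have choose2: "of_nat (Suc j choose 2) = of_nat (Suc j) * of_nat j / (2::complex)" for j
    proof -
      have "real (Suc j choose 2) = real (Suc j) * real j / 2" by (induction j) (auto simp: field_simps numeral_2_eq_2)
      then show ?thesis by (metis of_real_of_nat_eq of_real_mult of_real_divide of_real_numeral)
    qed
    have G: "fps_nth G (Suc k) = of_nat (k + 3) * of_nat (k + 2) / 2 * u ^ Suc k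
        + x * (of_nat (k + 2) * of_nat (k + 1) / 2) * u ^ k" for k
    proof -
      have "fps_nth G (Suc k) = of_nat (Suc (k + 2) choose 2) * u ^ Suc k + x * (of_nat (Suc (k + 1) choose 2) * u ^ k)"
        by (simp add: G_def distrib_right kernel_fps_def mult.assoc del: binomial_Suc_Suc)
      then show ?thesis
        unfolding choose2 by (simp add: mult.assoc)
    qed
    define A where "A = of_real ((real n + 1) / 2) * W + of_real ((real n - 1) / 2) * Y"
    have expand: "k / p * (b * p / 2 * U + x * (p * e / 2) * V) = b / 2 * (k * U) + e / 2 * (k * x * V)"
      if "p \<noteq> 0" for p b e k U V :: complex
      using that by (simp add: field_simps)
    have "\<kappa> / of_nat n * fps_nth G (n - 1) = \<kappa> / of_nat (m + 2) *
        (of_nat (m + 3) * of_nat (m + 2) / 2 * u ^ Suc m + x * (of_nat (m + 2) * of_nat (m + 1) / 2) * u ^ m)"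
      using G[of m] by (simp add: m)
    also have "\<dots> = of_nat (m + 3) / 2 * (\<kappa> * u ^ Suc m) + of_nat (m + 1) / 2 * (\<kappa> * x * u ^ m)"
      by (rule expand) (metis of_nat_eq_0_iff add_is_0 zero_neq_numeral)
    also have "\<dots> = A"
      by (simp add: A_def W_def Y_def m algebra_simps)
    finally have A: "\<kappa> / of_nat n * fps_nth G (n - 1) = A" .
    have "\<kappa>\<^sup>2 / of_nat (2 * n - 1) * fps_nth G (2 * n - 2) = \<kappa>\<^sup>2 / of_nat (2 * m + 3) *
        (of_nat (2 * m + 4) * of_nat (2 * m + 3) / 2 * u ^ Suc (2 * m + 1)
          + x * (of_nat (2 * m + 3) * of_nat (2 * m + 2) / 2) * u ^ (2 * m + 1))"
    proof -
      have "2 * n - 2 = Suc (2 * m + 1)" "2 * n - 1 = 2 * m + 3"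
        "2 * m + 1 + 3 = 2 * m + 4" "2 * m + 1 + 2 = 2 * m + 3" "2 * m + 1 + 1 = 2 * m + 2"
        using m by simp_all
      then show ?thesis using G[of "2 * m + 1"] by (simp only:)
    qed
    also have "\<dots> = of_nat (2 * m + 4) / 2 * (\<kappa>\<^sup>2 * u ^ Suc (2 * m + 1)) + of_nat (2 * m + 2) / 2 * (\<kappa>\<^sup>2 * x * u ^ (2 * m + 1))"
      by (rule expand) (metis of_nat_eq_0_iff add_is_0 zero_neq_numeral)
    also have "\<dots> = of_real (real n) * W\<^sup>2 + of_real (real n - 1) * (W * Y)"
    proof -
      have "u ^ Suc (2 * m + 1) = u ^ Suc m * u ^ Suc m" "u ^ (2 * m + 1) = u ^ Suc m * u ^ m"
        by (simp_all add: mult_2 power_add)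
      moreover have "of_nat (2 * m + 4) / 2 = complex_of_real (real n)" "of_nat (2 * m + 2) / 2 = complex_of_real (real n - 1)"
        by (simp_all add: m)
      moreover have "W = \<kappa> * u ^ Suc m" "Y = \<kappa> * x * u ^ m"
        by (simp_all add: W_def Y_def m)
      ultimately show ?thesis by (simp only: power2_eq_square mult_ac)
    qed
    finally have B: "\<kappa>\<^sup>2 / of_nat (2 * n - 1) * fps_nth G (2 * n - 2)
        = of_real (real n) * W\<^sup>2 + of_real (real n - 1) * (W * Y)" .
    \<comment> \<open>The tangent line lies below the parabola; this returns from the linear
      functional to the quadratic one at the extremal functions.\<close>
    have "2 * s * Re A \<le> s\<^sup>2 + (Re A)\<^sup>2"
      using zero_le_power2[of "s - Re A"] by (simp add: power2_diff)
    then have "lam * (2 * s * Re A) \<le> lam * (s\<^sup>2 + (Re A)\<^sup>2)"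
      using \<open>lam \<ge> 0\<close> by (rule mult_left_mono)
    moreover have "lam * (Re A)\<^sup>2 - (real n * Re (W\<^sup>2) + (real n - 1) * Re (W * Y)) \<le> M"
    proof -
      have "Re A = (real n + 1) / 2 * Re W + (real n - 1) / 2 * Re Y"
        by (simp only: A_def plus_complex.sel Re_of_real_mult)
      moreover have "cmod W = 1" "cmod Y = 1"
        using xu \<kappa>(1) by (simp_all add: W_def Y_def norm_mult norm_power)
      ultimately show ?thesis using extremal[of W Y] by simp
    qed
    moreover have "(\<Sum>k\<le>2 * n - 2. d k * fps_nth G k) = of_real (2 * lam * s) * A - (of_real (real n) * W\<^sup>2 + of_real (real n - 1) * (W * Y))"
      unfolding d B[symmetric] A[symmetric] by simp
    then have "Re (\<Sum>k\<le>2 * n - 2. d k * fps_nth G k)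
        = 2 * lam * s * Re A - (real n * Re (W\<^sup>2) + (real n - 1) * Re (W * Y))"
      by (simp only: minus_complex.sel plus_complex.sel Re_of_real_mult)
    ultimately show "Re (\<Sum>k\<le>2 * n - 2. d k * fps_nth ((1 + fps_const x * fps_X) * kernel_fps 2 u) k) \<le> lam * s\<^sup>2 + M"
      unfolding G_def[symmetric] by (simp only: distrib_left mult_ac)
  qed
  moreover have "(\<Sum>k\<le>2 * n - 2. d k * fps_nth (fps_deriv F) k) = of_real (2 * lam * s) * (\<kappa> * a n) - \<kappa>\<^sup>2 * a (2 * n - 1)"
  proof -
    have coeffs: "fps_nth (fps_deriv F) (n - 1) = of_nat n * a n"
      "fps_nth (fps_deriv F) (2 * n - 2) = of_nat (2 * n - 1) * a (2 * n - 1)"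
      using n by (auto simp: F_def of_nat_diff Suc_diff_Suc numeral_2_eq_2)
    have nonzero: "complex_of_nat n \<noteq> 0" "complex_of_nat (2 * n - 1) \<noteq> 0"
      unfolding of_nat_eq_0_iff using n by simp_all
    have cancel: "b / p * (p * y) = b * y" if "p \<noteq> 0" for b p y :: complex
      using that by simp
    have "(\<Sum>k\<le>2 * n - 2. d k * fps_nth (fps_deriv F) k) = 2 * of_real (lam * s) * \<kappa> * a n - \<kappa>\<^sup>2 * a (2 * n - 1)"
      unfolding d coeffs by (simp only: cancel nonzero not_False_eq_True)
    then show ?thesis by (simp add: mult.assoc)
  qed
  ultimately have "2 * lam * s * s - Re (\<kappa>\<^sup>2 * a (2 * n - 1)) \<le> lam * s\<^sup>2 + M"
    by (simp only: minus_complex.sel Re_of_real_mult s_def)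
  then have "lam * s\<^sup>2 - Re (\<kappa>\<^sup>2 * a (2 * n - 1)) \<le> M"
    by (simp add: power2_eq_square)
  moreover have "lam * Re ((\<kappa> * a n)\<^sup>2) \<le> lam * s\<^sup>2"
    unfolding s_def using \<open>lam \<ge> 0\<close> by (intro mult_left_mono Re_power2_le)
  moreover have "cmod z = lam * Re ((\<kappa> * a n)\<^sup>2) - Re (\<kappa>\<^sup>2 * a (2 * n - 1))"
  proof -
    have "of_real (cmod z) = of_real lam * (\<kappa> * a n)\<^sup>2 - \<kappa>\<^sup>2 * a (2 * n - 1)"
      unfolding \<kappa>(2) unfolding z_def by (simp add: power2_eq_square algebra_simps)
    then have "Re (of_real (cmod z)) = Re (of_real lam * (\<kappa> * a n)\<^sup>2 - \<kappa>\<^sup>2 * a (2 * n - 1))" by simp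
    then show ?thesis by (simp only: Re_complex_of_real minus_complex.sel Re_of_real_mult)
  qed
  ultimately show ?thesis unfolding z_def by linarith
qed

text \<open>Differentiating the geometric series gives the coefficients k, and power series are
  unique.\<close>

lemma koebe_coefficients:
  assumes "has_normalized_expansion f a" "\<And>z. z \<in> unit_disk \<Longrightarrow> f z = koebe z" "k \<ge> 2"
  shows "a k = of_nat k"
proof -
  have "(\<lambda>k. of_nat k * z ^ k) sums koebe z" if "z \<in> unit_disk" for z
  proof -
    have "(\<lambda>k. z * (of_nat (Suc k) * z ^ k)) sums (z * (1 / (1 - z)\<^sup>2))"
      using that by (intro sums_mult geometric_deriv_sums) simp
    then have "(\<lambda>k. of_nat (Suc k) * z ^ Suc k) sums koebe z"
      by (simp add: koebe_def mult_ac)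
    from sums_Suc[OF this] show ?thesis by simp
  qed
  then have "f has_fps_expansion Abs_fps of_nat"
    using assms(2) by (intro has_fps_expansionI eventually_mono[OF eventually_nhds_in_open[of unit_disk 0]]) auto
  then have "Abs_fps of_nat = Abs_fps (\<lambda>k. if k = 0 then 0 else if k = 1 then 1 else a k)"
    using has_normalized_expansion_imp_has_fps_expansion[OF assms(1)] fps_expansion_unique_complex by blast
  then show ?thesis using assms(3) by (auto simp: fps_eq_iff dest!: spec[of _ k])
qed

theorem theorem1:
  fixes n :: nat and lam :: real
    and f :: "complex \<Rightarrow> complex" and a :: "nat \<Rightarrow> complex"
  assumes "n \<ge> 3" and "lam > 0"
    and "f \<in> close_to_convex"
    and "has_normalized_expansion f a"
  shows
    "(lam \<ge> (3 * real n + sqrt (5 * (real n)\<^sup>2 - 4 * real n)) / ((real n)\<^sup>2 + real n) \<longrightarrow>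
        cmod (of_real lam * (a n)\<^sup>2 - a (2 * n - 1)) \<le> lam * (real n)\<^sup>2 - (2 * real n - 1) \<and>
        ((\<forall>z\<in>unit_disk. f z = koebe z) \<longrightarrow>
           cmod (of_real lam * (a n)\<^sup>2 - a (2 * n - 1)) = lam * (real n)\<^sup>2 - (2 * real n - 1)))
     \<and>
     (2 * real n / ((real n)\<^sup>2 - real n + 1) < lam \<and>
      lam < (3 * real n + sqrt (5 * (real n)\<^sup>2 - 4 * real n)) / ((real n)\<^sup>2 + real n) \<longrightarrow>
        cmod (of_real lam * (a n)\<^sup>2 - a (2 * n - 1)) \<le>
          (lam * (4 * real n * (real n + 1) - (3 * (real n)\<^sup>2 + 1) * lam)
             + 4 * real n * (2 - lam) * sqrt (real n * lam * (2 - lam)))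
          / (lam * (8 * real n - lam * (real n + 1)\<^sup>2)))
     \<and>
     (lam \<le> 2 * real n / ((real n)\<^sup>2 - real n + 1) \<longrightarrow>
        cmod (of_real lam * (a n)\<^sup>2 - a (2 * n - 1)) \<le> 2 * real n - 1)"
proof (intro conjI impI)
  have n: "real n \<ge> 3" "n \<ge> 2" using assms(1) by auto
  note bound = generalized_Zalcman_bound[OF n(2) less_imp_le[OF assms(2)] assms(3,4)]
  {
    assume lam: "lam \<ge> (3 * real n + sqrt (5 * (real n)\<^sup>2 - 4 * real n)) / ((real n)\<^sup>2 + real n)"
    show le: "cmod (of_real lam * (a n)\<^sup>2 - a (2 * n - 1)) \<le> lam * (real n)\<^sup>2 - (2 * real n - 1)"
      by (rule bound, rule extremal_bound_large_lambda[OF n(1) lam])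
    assume "\<forall>z\<in>unit_disk. f z = koebe z"
    then have "a n = of_nat n" "a (2 * n - 1) = of_nat (2 * n - 1)"
      using koebe_coefficients[OF assms(4)] n by auto
    then have "of_real lam * (a n)\<^sup>2 - a (2 * n - 1) = of_real (lam * (real n)\<^sup>2 - (2 * real n - 1))"
      using n by (simp add: of_nat_diff)
    \<comment> \<open>The sign is read off from the bound just proved, whose left-hand side is a
      modulus.\<close>
    moreover have "0 \<le> lam * (real n)\<^sup>2 - (2 * real n - 1)"
      using le norm_ge_zero order_trans by blast
    ultimately show "cmod (of_real lam * (a n)\<^sup>2 - a (2 * n - 1)) = lam * (real n)\<^sup>2 - (2 * real n - 1)"
      by (simp only: norm_of_real abs_of_nonneg)
  }
  {
    assume "2 * real n / ((real n)\<^sup>2 - real n + 1) < lam \<and>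
      lam < (3 * real n + sqrt (5 * (real n)\<^sup>2 - 4 * real n)) / ((real n)\<^sup>2 + real n)"
    then show "cmod (of_real lam * (a n)\<^sup>2 - a (2 * n - 1)) \<le>
          (lam * (4 * real n * (real n + 1) - (3 * (real n)\<^sup>2 + 1) * lam)
             + 4 * real n * (2 - lam) * sqrt (real n * lam * (2 - lam)))
          / (lam * (8 * real n - lam * (real n + 1)\<^sup>2))"
      by (intro bound extremal_bound_middle_lambda[OF n(1) assms(2)]) auto
  }
  {
    assume "lam \<le> 2 * real n / ((real n)\<^sup>2 - real n + 1)"
    then show "cmod (of_real lam * (a n)\<^sup>2 - a (2 * n - 1)) \<le> 2 * real n - 1"
      by (intro bound extremal_bound_small_lambda[OF n(1) assms(2)])
  }
qed

end
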